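(* Suppose that $\tilde c^u,\tilde c^l,\tilde d^{ku},\tilde d^{kl}$, $k\in\mathbb{K}$, are known, that $\zeta^u(s'|s,a)\ge0$ and $\zeta^l(s'|s,a)\le0$ for all $(s,a)\in\mathcal{K}$, $s'\in S$, and that the $|\mathcal{K}|$ random vectors $(\zeta(s'|s,a))_{s'\in S}$, $(s,a)\in\mathcal{K}$, are independent. Let $h_0^{rp}>0$, $h_k^{rp}>0$, $k\in\mathbb{K}$, be arbitrarily fixed, and put $$A_C(s,a)=\frac{-\sum_{s'\in S\setminus\{s_c\}}C_{\max}^{s_c}(s')\zeta^l(s'|s,a)}{\sum_{s'\in S\setminus\{s_c\}}C_{\max}^{s_c}(s')\big(\zeta^u(s'|s,a)-\zeta^l(s'|s,a)\big)},\qquad A_{D^k}(s,a)=\frac{-\sum_{s'\in S\setminus\{s_{d^k}\}}D_{\max}^{k,s_{d^k}}(s')\zeta^l(s'|s,a)}{\sum_{s'\in S\setminus\{s_{d^k}\}}D_{\max}^{k,s_{d^k}}(s')\big(\zeta^u(s'|s,a)-\zeta^l(s'|s,a)\big)}$$ for $(s,a)\in\mathcal{K}$, $k\in\mathbb{K}$. Then, with $\mathcal{R}_c$, $\mathcal{R}_{d^k}$, $\mathcal{Q}_M^\alpha(\gamma)$ as defined in the context, the following is a convex programming problem whose optimal value is an upper bound to the optimal value of the problem (JCCMDP) defined in the context: $$\min_{z,\rho}\ z\quad\text{subject to}$$ $$\sum_{(s,a)\in\mathcal{K}}\ln\Big\{A_C(s,a)\exp\Big(h_0^{rp}\rho(s,a)\sum_{s'\in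 S\setminus\{s_c\}}C_{\max}^{s_c}(s')\zeta^u(s'|s,a)\Big)+\big(1-A_C(s,a)\big)\exp\Big(h_0^{rp}\rho(s,a)\sum_{s'\in S\setminus\{s_c\}}C_{\max}^{s_c}(s')\zeta^l(s'|s,a)\Big)\Big\}\le\ln(1-p_0)+h_0^{rp}\mathcal{R}_c,$$ $$\sum_{(s,a)\in\mathcal{K}}\ln\Big\{A_{D^k}(s,a)\exp\Big(h_k^{rp}\rho(s,a)\sum_{s'\in S\setminus\{s_{d^k}\}}D_{\max}^{k,s_{d^k}}(s')\zeta^u(s'|s,a)\Big)+\big(1-A_{D^k}(s,a)\big)\exp\Big(h_k^{rp}\rho(s,a)\sum_{s'\in S\setminus\{s_{d^k}\}}D_{\max}^{k,s_{d^k}}(s')\zeta^l(s'|s,a)\Big)\Big\}\le\ln\frac{1-p_1}{K}+h_k^{rp}\mathcal{R}_{d^k}\quad\forall k\in\mathbb{K},$$ $$\rho\in\mathcal{Q}_M^\alpha(\gamma).$$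
   Context: Setting. $S$ is a finite nonempty state space, $A(s)$ a finite nonempty action set for each $s\in S$, $\mathcal{K}=\{(s,a):s\in S,a\in A(s)\}$, $\alpha\in(0,1)$, $\gamma$ a probability distribution on $S$, $\mathbb{K}=\{1,\dots,K\}$, $\xi_k\in\mathbb{R}$, $p_0,p_1\in(0,1)$. On a probability space $(\Omega,\mathcal{F},\mathbb{P})$ there are random running costs $\tilde c(s,a)$, $\tilde d^k(s,a)$ and random transition probabilities $\tilde p(s'|s,a)(\omega)=\mu(s'|s,a)+\zeta(s'|s,a)(\omega)$, where $\mu(s'|s,a)=\mathbb{E}\,\tilde p(s'|s,a)$; for every $\omega$, both $\tilde p(\cdot|s,a)(\omega)$ and $\mu(\cdot|s,a)$ are probability distributions on $S$ (hence $\sum_{s'}\zeta(s'|s,a)(\omega)=0$, $\mathbb{E}\zeta(s'|s,a)=0$). Bounds, valid for all $\omega$: $\tilde c^l\le\tilde c\le\tilde c^u$, $\tilde d^{kl}\le\tilde d^k\le\tilde d^{ku}$ componentwise, and $\zeta^l(s'|s,a)\le\zeta(s'|s,a)\le\zeta^u(s'|s,a)$. Stationary policies: $F_S$ is the set of $f=(f(s))_{s\in S}$ with $f(s)=(f(s,a))_{a\in A(s)}$ a probability distribution on $A(s)$. For $f\in F_S$: $\tilde c_f(s)=\sum_{a}f(s,a)\tilde c(s,a)$, $\tilde d^k_f(s)=\sum_a f(s,a)\tilde d^k(s,a)$, $\tilde P_f(\omega)$ is the matrix with $(s,s')$ entry $\sum_a f(s,a)\tilde p(s'|s,a)(\omega)$,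 $\tilde Q_f(\omega)=(I-\alpha\tilde P_f(\omega))^{-1}$, and the random expected discounted costs are $\tilde C(\gamma,f)=(1-\alpha)\gamma^T\tilde Q_f\tilde c_f$, $\tilde D^k(\gamma,f)=(1-\alpha)\gamma^T\tilde Q_f\tilde d^k_f$. The problem considered is $$(\mathrm{JCCMDP})\quad\min_{z\in\mathbb{R},f\in F_S}z\ \ \text{s.t.}\ \ \mathbb{P}\big(\tilde C(\gamma,f)\le z\big)\ge p_0,\quad\mathbb{P}\big(\tilde D^k(\gamma,f)\le\xi_k\ \forall k\in\mathbb{K}\big)\ge p_1.$$ Notation. $c_{\max}=\max_{\mathcal{K}}\tilde c^u(s,a)$, $c_{\min}=\min_{\mathcal{K}}\tilde c^l(s,a)$, $d^k_{\max}=\max_{\mathcal{K}}\tilde d^{ku}(s,a)$, $d^k_{\min}=\min_{\mathcal{K}}\tilde d^{kl}(s,a)$; $C_{\max}(s)=\max_{a\in A(s)}\tilde c^u(s,a)+\frac{\alpha}{1-\alpha}c_{\max}$, $C_{\min}(s)=\min_{a\in A(s)}\tilde c^l(s,a)+\frac{\alpha}{1-\alpha}c_{\min}$, $D^k_{\max}(s)=\max_{a\in A(s)}\tilde d^{ku}(s,a)+\frac{\alpha}{1-\alpha}d^k_{\max}$, $D^k_{\min}(s)=\min_{a\in A(s)}\tilde d^{kl}(s,a)+\frac{\alpha}{1-\alpha}d^k_{\min}$. Fix $s_c\in\arg\min_{s'}C_{\max}(s')$, $s_{d^k}\in\arg\min_{s'}D^k_{\max}(s')$, and put $C_{\max}^{s_c}(s')=C_{\max}(s')-C_{\max}(s_c)$,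 $D_{\max}^{k,s_{d^k}}(s')=D^k_{\max}(s')-D^k_{\max}(s_{d^k})$. Define $\mathcal{R}_c,\mathcal{R}_{d^k}$ by $$\alpha\mathcal{R}_c=z-\rho^T\tilde c^u+\alpha\sum_{(s,a)\in\mathcal{K}}\sum_{s'\in S}\rho(s,a)\big(C_{\max}(s')-C_{\min}(s')\big)\zeta^l(s'|s,a),$$ $$\alpha\mathcal{R}_{d^k}=\xi_k-\rho^T\tilde d^{ku}+\alpha\sum_{(s,a)\in\mathcal{K}}\sum_{s'\in S}\rho(s,a)\big(D^k_{\max}(s')-D^k_{\min}(s')\big)\zeta^l(s'|s,a).$$ $\mathcal{Q}_M^\alpha(\gamma)$ is the set of $\rho\in\mathbb{R}^{|\mathcal{K}|}$ with $\rho\ge0$ and $\sum_{(s,a)\in\mathcal{K}}\rho(s,a)(\delta(s',s)-\alpha\mu(s'|s,a))=(1-\alpha)\gamma(s')$ for all $s'\in S$, with $\delta$ the Kronecker delta. The optimal value of a minimization problem is the infimum of its objective over its feasible set ($+\infty$ if infeasible). "Convex programming problem" means a linear objective, with all constraints being linear or of the form $g\le0$ with $g$ a convex function of the variables. *)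

theory Defs
  imports "HOL-Probability.Probability"
begin

section \<open>Optimization problems\<close>

definition optimal_value :: "('v \<Rightarrow> real) \<Rightarrow> 'v set \<Rightarrow> ereal" where
  "optimal_value obj X = (INF x\<in>X. ereal (obj x))"

text \<open>A minimization problem is kept together with the list of its constraints, so that being a
  convex programming problem is a property of the constraint functions and not merely of the
  feasible set. A pair \<open>(L, b)\<close> in \<open>lin_eqs\<close> or \<open>lin_ineqs\<close> stands for \<open>L x = b\<close> or \<open>L x \<le> b\<close>; a
  function \<open>g\<close> in \<open>nonlin_ineqs\<close> stands for \<open>g x \<le> 0\<close>.\<close>

record 'v program =
  objective :: "'v \<Rightarrow> real"
  nonlin_ineqs :: "('v \<Rightarrow> real) set"
  lin_ineqs :: "(('v \<Rightarrow> real) \<times> real) set"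
  lin_eqs :: "(('v \<Rightarrow> real) \<times> real) set"

definition program_feasible :: "'v program \<Rightarrow> 'v set" where
  "program_feasible P =
     {x. (\<forall>g\<in>nonlin_ineqs P. g x \<le> 0) \<and> (\<forall>(L, b)\<in>lin_ineqs P. L x \<le> b) \<and>
         (\<forall>(L, b)\<in>lin_eqs P. L x = b)}"

definition convex_program :: "('v::real_vector) program \<Rightarrow> bool" where
  "convex_program P \<longleftrightarrow>
     linear (objective P) \<and>
     finite (nonlin_ineqs P) \<and> (\<forall>g\<in>nonlin_ineqs P. convex_on UNIV g) \<and>
     finite (lin_ineqs P) \<and> (\<forall>(L, b)\<in>lin_ineqs P. linear L) \<and>
     finite (lin_eqs P) \<and> (\<forall>(L, b)\<in>lin_eqs P. linear L)"


section \<open>The jointly chance-constrained Markov decision problem\<close>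

text \<open>States are the elements of the finite type \<open>'s\<close>; \<open>A s\<close> is the set of actions available in
  state \<open>s\<close>. Transition data are written \<open>p s a s'\<close> for \<open>p(s'|s,a)\<close>.\<close>

definition state_actions :: "('s \<Rightarrow> 'a set) \<Rightarrow> ('s \<times> 'a) set" where
  "state_actions A = (SIGMA s:UNIV. A s)"

text \<open>Policies are extended by zero to unavailable actions.\<close>

definition stationary_policies :: "('s \<Rightarrow> 'a set) \<Rightarrow> ('s \<Rightarrow> 'a \<Rightarrow> real) set" where
  "stationary_policies A =
     {f. \<forall>s. (\<forall>a\<in>A s. 0 \<le> f s a) \<and> (\<Sum>a\<in>A s. f s a) = 1 \<and> (\<forall>a. a \<notin> A s \<longrightarrow> f s a = 0)}"

definition policy_cost ::
  "('s::finite \<Rightarrow> 'a set) \<Rightarrow> ('s \<Rightarrow> 'a \<Rightarrow> 'w \<Rightarrow> real) \<Rightarrow> ('s \<Rightarrow> 'a \<Rightarrow> real) \<Rightarrow> 'w \<Rightarrow> real ^ 's" where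
  "policy_cost A c f \<omega> = (\<chi> s. \<Sum>a\<in>A s. f s a * c s a \<omega>)"

definition policy_matrix ::
  "('s::finite \<Rightarrow> 'a set) \<Rightarrow> ('s \<Rightarrow> 'a \<Rightarrow> 's \<Rightarrow> 'w \<Rightarrow> real) \<Rightarrow> ('s \<Rightarrow> 'a \<Rightarrow> real) \<Rightarrow> 'w
     \<Rightarrow> real ^ 's ^ 's" where
  "policy_matrix A p f \<omega> = (\<chi> s s'. \<Sum>a\<in>A s. f s a * p s a s' \<omega>)"

definition discounted_cost ::
  "('s::finite \<Rightarrow> 'a set) \<Rightarrow> real \<Rightarrow> real ^ 's \<Rightarrow> ('s \<Rightarrow> 'a \<Rightarrow> 's \<Rightarrow> 'w \<Rightarrow> real) \<Rightarrow>
   ('s \<Rightarrow> 'a \<Rightarrow> 'w \<Rightarrow> real) \<Rightarrow> ('s \<Rightarrow> 'a \<Rightarrow> real) \<Rightarrow> 'w \<Rightarrow> real" where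
  "discounted_cost A \<alpha> \<gamma> p c f \<omega> =
     (1 - \<alpha>) * (\<gamma> \<bullet> (matrix_inv (mat 1 - \<alpha> *\<^sub>R policy_matrix A p f \<omega>) *v policy_cost A c f \<omega>))"

definition jccmdp_feasible ::
  "'w measure \<Rightarrow> ('s::finite \<Rightarrow> 'a set) \<Rightarrow> real \<Rightarrow> real ^ 's \<Rightarrow> ('s \<Rightarrow> 'a \<Rightarrow> 's \<Rightarrow> 'w \<Rightarrow> real) \<Rightarrow>
   ('s \<Rightarrow> 'a \<Rightarrow> 'w \<Rightarrow> real) \<Rightarrow> (nat \<Rightarrow> 's \<Rightarrow> 'a \<Rightarrow> 'w \<Rightarrow> real) \<Rightarrow> nat \<Rightarrow> (nat \<Rightarrow> real) \<Rightarrow>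
   real \<Rightarrow> real \<Rightarrow> (real \<times> ('s \<Rightarrow> 'a \<Rightarrow> real)) set" where
  "jccmdp_feasible M A \<alpha> \<gamma> p c d K \<xi> p0 p1 =
     {(z, f). f \<in> stationary_policies A \<and>
        measure M {\<omega> \<in> space M. discounted_cost A \<alpha> \<gamma> p c f \<omega> \<le> z} \<ge> p0 \<and>
        measure M {\<omega> \<in> space M. \<forall>k\<in>{1..K}. discounted_cost A \<alpha> \<gamma> p (d k) f \<omega> \<le> \<xi> k} \<ge> p1}"


section \<open>The surrogate problem\<close>

text \<open>The quantities for the running cost \<open>c\<close> and for each \<open>d\<^sup>k\<close> are built in the same way, so they
  are defined once: \<open>u\<close> and \<open>l\<close> stand for the upper and lower bounds of the cost in question.
  For \<open>u\<close> the upper bound of \<open>c\<close>, \<open>cost_max A \<alpha> u\<close> is the function \<open>C\<^sub>m\<^sub>a\<^sub>x\<close>, and \<open>cost_excess A \<alpha> u s0\<close>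
  is \<open>s' \<mapsto> C\<^sub>m\<^sub>a\<^sub>x(s') - C\<^sub>m\<^sub>a\<^sub>x(s0)\<close>.\<close>

definition cost_max ::
  "('s \<Rightarrow> 'a set) \<Rightarrow> real \<Rightarrow> ('s \<Rightarrow> 'a \<Rightarrow> real) \<Rightarrow> 's \<Rightarrow> real" where
  "cost_max A \<alpha> u s =
     Max (u s ` A s) + \<alpha> / (1 - \<alpha>) * Max ((\<lambda>(s', a). u s' a) ` state_actions A)"

definition cost_min ::
  "('s \<Rightarrow> 'a set) \<Rightarrow> real \<Rightarrow> ('s \<Rightarrow> 'a \<Rightarrow> real) \<Rightarrow> 's \<Rightarrow> real" where
  "cost_min A \<alpha> l s =
     Min (l s ` A s) + \<alpha> / (1 - \<alpha>) * Min ((\<lambda>(s', a). l s' a) ` state_actions A)"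

definition cost_excess ::
  "('s \<Rightarrow> 'a set) \<Rightarrow> real \<Rightarrow> ('s \<Rightarrow> 'a \<Rightarrow> real) \<Rightarrow> 's \<Rightarrow> 's \<Rightarrow> real" where
  "cost_excess A \<alpha> u s0 s' = cost_max A \<alpha> u s' - cost_max A \<alpha> u s0"

text \<open>If the denominator vanishes, the quotient is \<open>0\<close> by the convention \<open>x / 0 = 0\<close>. For
  \<open>W \<ge> 0\<close> and \<open>\<zeta>l \<le> 0 \<le> \<zeta>u\<close> all products \<open>W s' * \<zeta>l s a s'\<close> and \<open>W s' * \<zeta>u s a s'\<close> with
  \<open>s' \<noteq> s0\<close> are then zero, so that the value of the coefficient does not matter in
  \<open>log_mgf_bound\<close>: the summand of \<open>(s, a)\<close> is \<open>ln 1\<close>.\<close>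

definition mixing_coeff ::
  "('s::finite \<Rightarrow> real) \<Rightarrow> 's \<Rightarrow> ('s \<Rightarrow> 'a \<Rightarrow> 's \<Rightarrow> real) \<Rightarrow> ('s \<Rightarrow> 'a \<Rightarrow> 's \<Rightarrow> real) \<Rightarrow>
   's \<Rightarrow> 'a \<Rightarrow> real" where
  "mixing_coeff W s0 \<zeta>l \<zeta>u s a =
     - (\<Sum>s'\<in>UNIV - {s0}. W s' * \<zeta>l s a s') /
       (\<Sum>s'\<in>UNIV - {s0}. W s' * (\<zeta>u s a s' - \<zeta>l s a s'))"

text \<open>Vectors indexed by state-action pairs are elements of \<open>real ^ ('s \<times> 'a)\<close> vanishing outside
  \<open>state_actions A\<close>.\<close>

definition log_mgf_bound ::
  "('s::finite \<Rightarrow> 'a::finite set) \<Rightarrow> ('s \<Rightarrow> real) \<Rightarrow> 's \<Rightarrow> ('s \<Rightarrow> 'a \<Rightarrow> 's \<Rightarrow> real) \<Rightarrow>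
   ('s \<Rightarrow> 'a \<Rightarrow> 's \<Rightarrow> real) \<Rightarrow> real \<Rightarrow> real ^ ('s \<times> 'a) \<Rightarrow> real" where
  "log_mgf_bound A W s0 \<zeta>l \<zeta>u h \<rho> =
     (\<Sum>(s, a)\<in>state_actions A. ln (
        mixing_coeff W s0 \<zeta>l \<zeta>u s a *
          exp (h * \<rho> $ (s, a) * (\<Sum>s'\<in>UNIV - {s0}. W s' * \<zeta>u s a s')) +
        (1 - mixing_coeff W s0 \<zeta>l \<zeta>u s a) *
          exp (h * \<rho> $ (s, a) * (\<Sum>s'\<in>UNIV - {s0}. W s' * \<zeta>l s a s'))))"

text \<open>\<open>residual A \<alpha> u l \<zeta>l z \<rho>\<close> is \<open>\<R>\<^sub>c\<close>, and the same with \<open>\<xi>\<^sub>k\<close> in place of \<open>z\<close> and the bounds of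
  \<open>d\<^sup>k\<close> is \<open>\<R>\<close> for \<open>d\<^sup>k\<close>.\<close>

definition residual ::
  "('s::finite \<Rightarrow> 'a::finite set) \<Rightarrow> real \<Rightarrow> ('s \<Rightarrow> 'a \<Rightarrow> real) \<Rightarrow> ('s \<Rightarrow> 'a \<Rightarrow> real) \<Rightarrow>
   ('s \<Rightarrow> 'a \<Rightarrow> 's \<Rightarrow> real) \<Rightarrow> real \<Rightarrow> real ^ ('s \<times> 'a) \<Rightarrow> real" where
  "residual A \<alpha> u l \<zeta>l t \<rho> =
     (t - (\<Sum>(s, a)\<in>state_actions A. \<rho> $ (s, a) * u s a)
        + \<alpha> * (\<Sum>(s, a)\<in>state_actions A. \<Sum>s'\<in>UNIV.
                 \<rho> $ (s, a) * (cost_max A \<alpha> u s' - cost_min A \<alpha> l s') * \<zeta>l s a s')) / \<alpha>"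

definition flow ::
  "('s::finite \<Rightarrow> 'a::finite set) \<Rightarrow> real \<Rightarrow> ('s \<Rightarrow> 'a \<Rightarrow> 's \<Rightarrow> real) \<Rightarrow> real ^ ('s \<times> 'a) \<Rightarrow> 's
     \<Rightarrow> real" where
  "flow A \<alpha> \<mu> \<rho> s' =
     (\<Sum>(s, a)\<in>state_actions A. \<rho> $ (s, a) * ((if s' = s then 1 else 0) - \<alpha> * \<mu> s a s'))"

definition occupation_measures ::
  "('s::finite \<Rightarrow> 'a::finite set) \<Rightarrow> real \<Rightarrow> ('s \<Rightarrow> 'a \<Rightarrow> 's \<Rightarrow> real) \<Rightarrow> real ^ 's
     \<Rightarrow> (real ^ ('s \<times> 'a)) set" where
  "occupation_measures A \<alpha> \<mu> \<gamma> =
     {\<rho>. (\<forall>x\<in>state_actions A. 0 \<le> \<rho> $ x) \<and> (\<forall>x. x \<notin> state_actions A \<longrightarrow> \<rho> $ x = 0) \<and>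
         (\<forall>s'. flow A \<alpha> \<mu> \<rho> s' = (1 - \<alpha>) * \<gamma> $ s')}"

definition surrogate_program ::
  "('s::finite \<Rightarrow> 'a::finite set) \<Rightarrow> real \<Rightarrow> real ^ 's \<Rightarrow> ('s \<Rightarrow> 'a \<Rightarrow> 's \<Rightarrow> real) \<Rightarrow>
   ('s \<Rightarrow> 'a \<Rightarrow> 's \<Rightarrow> real) \<Rightarrow> ('s \<Rightarrow> 'a \<Rightarrow> 's \<Rightarrow> real) \<Rightarrow>
   ('s \<Rightarrow> 'a \<Rightarrow> real) \<Rightarrow> ('s \<Rightarrow> 'a \<Rightarrow> real) \<Rightarrow>
   (nat \<Rightarrow> 's \<Rightarrow> 'a \<Rightarrow> real) \<Rightarrow> (nat \<Rightarrow> 's \<Rightarrow> 'a \<Rightarrow> real) \<Rightarrow>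
   nat \<Rightarrow> (nat \<Rightarrow> real) \<Rightarrow> real \<Rightarrow> real \<Rightarrow> 's \<Rightarrow> (nat \<Rightarrow> 's) \<Rightarrow> real \<Rightarrow> (nat \<Rightarrow> real) \<Rightarrow>
   (real \<times> (real ^ ('s \<times> 'a))) program" where
  "surrogate_program A \<alpha> \<gamma> \<mu> \<zeta>l \<zeta>u cl cu dl du K \<xi> p0 p1 sc sd h0 h =
     \<lparr>objective = (\<lambda>(z, \<rho>). z),
      nonlin_ineqs =
        {\<lambda>(z, \<rho>). log_mgf_bound A (cost_excess A \<alpha> cu sc) sc \<zeta>l \<zeta>u h0 \<rho>
                   - (ln (1 - p0) + h0 * residual A \<alpha> cu cl \<zeta>l z \<rho>)} \<union>
        (\<lambda>k (z, \<rho>). log_mgf_bound A (cost_excess A \<alpha> (du k) (sd k)) (sd k) \<zeta>l \<zeta>u (h k) \<rho>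
                   - (ln ((1 - p1) / real K) + h k * residual A \<alpha> (du k) (dl k) \<zeta>l (\<xi> k) \<rho>)) ` {1..K},
      lin_ineqs = (\<lambda>x. ((\<lambda>(z, \<rho>). - (\<rho> $ x)), 0)) ` state_actions A,
      lin_eqs =
        (\<lambda>x. ((\<lambda>(z, \<rho>). \<rho> $ x), 0)) ` (- state_actions A) \<union>
        (\<lambda>s'. ((\<lambda>(z, \<rho>). flow A \<alpha> \<mu> \<rho> s'), (1 - \<alpha>) * \<gamma> $ s')) ` UNIV\<rparr>"

lemma surrogate_program_feasible:
  "program_feasible (surrogate_program A \<alpha> \<gamma> \<mu> \<zeta>l \<zeta>u cl cu dl du K \<xi> p0 p1 sc sd h0 h) =
     {(z, \<rho>).
        log_mgf_bound A (cost_excess A \<alpha> cu sc) sc \<zeta>l \<zeta>u h0 \<rho>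
          \<le> ln (1 - p0) + h0 * residual A \<alpha> cu cl \<zeta>l z \<rho> \<and>
        (\<forall>k\<in>{1..K}. log_mgf_bound A (cost_excess A \<alpha> (du k) (sd k)) (sd k) \<zeta>l \<zeta>u (h k) \<rho>
          \<le> ln ((1 - p1) / real K) + h k * residual A \<alpha> (du k) (dl k) \<zeta>l (\<xi> k) \<rho>) \<and>
        \<rho> \<in> occupation_measures A \<alpha> \<mu> \<gamma>}"
  unfolding program_feasible_def surrogate_program_def occupation_measures_def
  by (auto simp: ball_Un)

end

theory Submission imports Defs begin

text \<open>Every feasible point \<open>(z, \<rho>)\<close> of the surrogate yields a point of the chance-constrained problem with
the same objective value: normalizing \<open>\<rho>\<close> in each state gives a stationary policy \<open>f\<close>
(\<open>occupation_measure_factorizes\<close>), and \<open>(z, f)\<close> is feasible. Hence the infimum of the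
chance-constrained problem cannot exceed that of the surrogate.

To see feasibility, fix one of the costs, with bounds \<open>l \<le> c \<le> u\<close>, and let \<open>v\<close> be the random value
vector of \<open>f\<close>, the solution of \<open>v = c\<^sub>f + \<alpha> P\<^sub>f v\<close>. Since \<open>\<rho>\<close> balances the mean transition law \<open>\<mu>\<close>,
pairing the balance equations with \<open>v\<close> cancels \<open>\<mu>\<close> and leaves only the noise \<open>\<zeta>\<close>
(\<open>discounted_cost_occupation\<close>): the discounted cost is
\<open>\<Sum> \<rho>(s,a) (c(s,a) + \<alpha> \<Sum> \<zeta>(s'|s,a) v(s'))\<close>. The vector \<open>v\<close> depends on all of the noise, but it lies
between the deterministic vectors \<open>cost_min\<close> and \<open>cost_max\<close>, and splitting \<open>\<zeta> = (\<zeta> - \<zeta>l) + \<zeta>l\<close> into a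
nonnegative and a nonpositive part replaces it by these. What remains random is a sum, weighted by
\<open>\<rho>\<close>, of independent bounded variables with mean zero, and the cost stays below its threshold as soon
as this sum is at most \<open>residual\<close> (\<open>discounted_cost_le\<close>).

The tail of that sum is controlled by the exponential Markov inequality, where each moment generating
function is bounded by replacing \<open>exp\<close> on the range of the variable by its chord
(\<open>chernoff_chord_bound\<close>). The logarithm of the resulting product is \<open>log_mgf_bound\<close>, so that a
constraint of the surrogate says exactly that the bound is at most \<open>1 - p0\<close>, or \<open>(1 - p1) / K\<close> for
each of the \<open>K\<close> costs of the joint constraint, to which the union bound applies.

The surrogate is convex because \<open>log_mgf_bound\<close> is a sum of log-sum-exp functions of \<open>\<rho>\<close> with
nonnegative weights (\<open>convex_on_ln_sum_exp\<close>) and all the remaining terms are affine.\<close>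

section \<open>Discounted evaluation with a stochastic matrix\<close>

text \<open>An average of \<open>v\<close> is at most its maximum \<open>m\<close>. At a maximizing state this gives \<open>m \<le> G + \<alpha> m\<close>, so
\<open>m \<le> G / (1 - \<alpha>)\<close>, which is then inserted into the fixed point equation at \<open>s\<close>.\<close>

lemma discounted_value_le:
  fixes P :: "real ^ 's::finite ^ 's" and v g :: "real ^ 's"
  assumes P: "\<And>s t. 0 \<le> P $ s $ t" "\<And>s. (\<Sum>t\<in>UNIV. P $ s $ t) = 1"
    and \<alpha>: "0 < \<alpha>" "\<alpha> < 1"
    and v: "v = g + \<alpha> *\<^sub>R (P *v v)"
    and g: "\<And>s. g $ s \<le> G"
  shows "v $ s \<le> g $ s + \<alpha> / (1 - \<alpha>) * G"
proof -
  define m where "m = Max (range (\<lambda>s. v $ s))"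
  have avg: "(P *v v) $ s \<le> m" for s
  proof -
    have "(P *v v) $ s = (\<Sum>t\<in>UNIV. P $ s $ t * v $ t)"
      by (simp add: matrix_vector_mult_def)
    also have "\<dots> \<le> (\<Sum>t\<in>UNIV. P $ s $ t * m)"
      by (intro sum_mono mult_left_mono P) (simp add: m_def)
    also have "\<dots> = m" by (simp add: P flip: sum_distrib_right)
    finally show ?thesis .
  qed
  have step: "v $ s \<le> g $ s + \<alpha> * m" for s
  proof -
    have "v $ s = g $ s + \<alpha> * (P *v v) $ s"
      using arg_cong[OF v, of "\<lambda>x. x $ s"] by simp
    with avg[of s] \<alpha> show ?thesis by simp
  qed
  have "m \<in> range (\<lambda>s. v $ s)" unfolding m_def by (rule Max_in) auto
  then obtain s1 where "m = v $ s1" by auto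
  with step[of s1] g[of s1] have "m * (1 - \<alpha>) \<le> G" by (simp add: algebra_simps)
  then have "m \<le> G / (1 - \<alpha>)" using \<alpha> by (simp add: pos_le_divide_eq)
  then have "\<alpha> * m \<le> \<alpha> / (1 - \<alpha>) * G" using \<alpha> mult_left_mono[of m _ \<alpha>] by fastforce
  with step[of s] show ?thesis by linarith
qed

lemma discounted_value_ge:
  fixes P :: "real ^ 's::finite ^ 's" and v g :: "real ^ 's"
  assumes P: "\<And>s t. 0 \<le> P $ s $ t" "\<And>s. (\<Sum>t\<in>UNIV. P $ s $ t) = 1"
    and \<alpha>: "0 < \<alpha>" "\<alpha> < 1"
    and v: "v = g + \<alpha> *\<^sub>R (P *v v)"
    and g: "\<And>s. G \<le> g $ s"
  shows "g $ s + \<alpha> / (1 - \<alpha>) * G \<le> v $ s"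
proof -
  have "- v = - (g + \<alpha> *\<^sub>R (P *v v))"
    by (rule arg_cong[OF v])
  also have "\<dots> = - g + \<alpha> *\<^sub>R (P *v (- v))"
    by (simp add: vec_eq_iff matrix_vector_mult_def sum_negf)
  finally have "- v = - g + \<alpha> *\<^sub>R (P *v (- v))" .
  from discounted_value_le[OF P \<alpha> this, of "- G" s] g show ?thesis by simp
qed

text \<open>A kernel vector is a fixed point for the cost zero, which the two preceding bounds force to vanish.\<close>

lemma det_discounted_nonzero:
  fixes P :: "real ^ 's::finite ^ 's"
  assumes P: "\<And>s t. 0 \<le> P $ s $ t" "\<And>s. (\<Sum>t\<in>UNIV. P $ s $ t) = 1"
    and \<alpha>: "0 < \<alpha>" "\<alpha> < 1"
  shows "det (mat 1 - \<alpha> *\<^sub>R P) \<noteq> 0"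
proof -
  have "x = 0" if "(mat 1 - \<alpha> *\<^sub>R P) *v x = 0" for x :: "real ^ 's"
  proof -
    have x: "x = 0 + \<alpha> *\<^sub>R (P *v x)"
      using that by (simp add: matrix_vector_mult_diff_rdistrib scaleR_matrix_vector_assoc)
    have "x $ s = 0" for s
      using discounted_value_le[OF P \<alpha> x, of 0 s] discounted_value_ge[OF P \<alpha> x, of 0 s] by simp
    then show ?thesis by (simp add: vec_eq_iff)
  qed
  then show ?thesis
    by (metis invertible_det_nz invertible_left_inverse matrix_left_invertible_ker)
qed

lemma matrix_inv_solves:
  fixes B :: "real ^ 'n::finite ^ 'n"
  assumes "det B \<noteq> 0"
  shows "B *v (matrix_inv B *v b) = b"
proof -
  have "B ** matrix_inv B = mat 1"
    using assms unfolding invertible_det_nz[symmetric] invertible_def matrix_inv_def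
    by (metis (mono_tags, lifting) someI_ex)
  then show ?thesis by (simp add: matrix_vector_mul_assoc)
qed

lemma borel_measurable_det:
  fixes B :: "'w \<Rightarrow> real ^ 'n::finite ^ 'n"
  assumes "\<And>i j. (\<lambda>\<omega>. B \<omega> $ i $ j) \<in> borel_measurable M"
  shows "(\<lambda>\<omega>. det (B \<omega>)) \<in> borel_measurable M"
  unfolding det_def
  by (intro borel_measurable_sum borel_measurable_times borel_measurable_prod borel_measurable_const assms)

text \<open>By Cramer's rule each component is a quotient of determinants, that is, of polynomials in the entries.\<close>

lemma borel_measurable_matrix_inv_mult:
  fixes B :: "'w \<Rightarrow> real ^ 'n::finite ^ 'n" and b :: "'w \<Rightarrow> real ^ 'n"
  assumes B: "\<And>i j. (\<lambda>\<omega>. B \<omega> $ i $ j) \<in> borel_measurable M"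
    and b: "\<And>i. (\<lambda>\<omega>. b \<omega> $ i) \<in> borel_measurable M"
    and det: "\<And>\<omega>. \<omega> \<in> space M \<Longrightarrow> det (B \<omega>) \<noteq> 0"
  shows "(\<lambda>\<omega>. (matrix_inv (B \<omega>) *v b \<omega>) $ k) \<in> borel_measurable M"
proof -
  let ?Bk = "\<lambda>\<omega>. (\<chi> i j. if j = k then b \<omega> $ i else B \<omega> $ i $ j) :: real ^ 'n ^ 'n"
  have "(\<lambda>\<omega>. ?Bk \<omega> $ i $ j) \<in> borel_measurable M" for i j
    by (cases "j = k") (simp_all add: B b)
  then have "(\<lambda>\<omega>. det (?Bk \<omega>) / det (B \<omega>)) \<in> borel_measurable M"
    by (intro borel_measurable_divide borel_measurable_det B)
  moreover have "(matrix_inv (B \<omega>) *v b \<omega>) $ k = det (?Bk \<omega>) / det (B \<omega>)" if "\<omega> \<in> space M" for \<omega>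
    by (subst cramer[OF det[OF that], THEN iffD1, OF matrix_inv_solves[OF det[OF that]]]) simp
  ultimately show ?thesis by (subst measurable_cong)
qed

section \<open>Occupation measures and policies\<close>

lemma finite_state_actions: "finite (state_actions A)" for A :: "'s::finite \<Rightarrow> 'a::finite set"
  by simp

lemma sum_state_actions:
  "(\<Sum>(s, a)\<in>state_actions A. g s a) = (\<Sum>s\<in>UNIV. \<Sum>a\<in>A s. g s a)"
  for A :: "'s::finite \<Rightarrow> 'a::finite set"
  unfolding state_actions_def by (rule sum.Sigma[symmetric]) auto

text \<open>In a state without mass all \<open>\<rho> $ (s, a)\<close> vanish, so any distribution on the actions will do there; the
uniform one is taken.\<close>

lemma occupation_measure_factorizes:
  fixes A :: "'s::finite \<Rightarrow> 'a::finite set"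
  assumes \<rho>: "\<rho> \<in> occupation_measures A \<alpha> \<mu> \<gamma>" and A: "\<And>s. A s \<noteq> {}"
  obtains f where "f \<in> stationary_policies A"
    "\<And>s a. a \<in> A s \<Longrightarrow> \<rho> $ (s, a) = (\<Sum>b\<in>A s. \<rho> $ (s, b)) * f s a"
proof
  define r where "r s = (\<Sum>b\<in>A s. \<rho> $ (s, b))" for s
  define f where "f s a = (if a \<in> A s then if r s = 0 then 1 / real (card (A s)) else \<rho> $ (s, a) / r s else 0)"
    for s a
  have nonneg: "0 \<le> \<rho> $ (s, a)" if "a \<in> A s" for s a
    using \<rho> that by (auto simp: occupation_measures_def state_actions_def)
  then have r: "0 \<le> r s" for s by (auto simp: r_def intro: sum_nonneg)
  have "(\<Sum>a\<in>A s. f s a) = 1" for s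
    using A[of s] by (cases "r s = 0") (auto simp: f_def r_def simp flip: sum_divide_distrib)
  then show "f \<in> stationary_policies A"
    using nonneg r by (auto simp: stationary_policies_def f_def)
  show "\<rho> $ (s, a) = (\<Sum>b\<in>A s. \<rho> $ (s, b)) * f s a" if "a \<in> A s" for s a
  proof (cases "r s = 0")
    case True
    then have "\<rho> $ (s, a) = 0"
      using sum_nonneg_eq_0_iff[of "A s" "\<lambda>b. \<rho> $ (s, b)"] nonneg that by (auto simp: r_def)
    with True show ?thesis by (simp add: r_def)
  next
    case False
    then show ?thesis using that by (simp add: f_def r_def)
  qed
qed

text \<open>The balance equations tested against \<open>v\<close>: summation by parts moves \<open>\<delta> - \<alpha> \<mu>\<close> from \<open>\<rho>\<close> to \<open>v\<close>.\<close>

lemma occupation_measure_pairing: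
  fixes v :: "real ^ 's::finite" and A :: "'s \<Rightarrow> 'a::finite set"
  assumes \<rho>: "\<rho> \<in> occupation_measures A \<alpha> \<mu> \<gamma>"
  shows "(1 - \<alpha>) * (\<gamma> \<bullet> v) =
    (\<Sum>(s, a)\<in>state_actions A. \<rho> $ (s, a) * (v $ s - \<alpha> * (\<Sum>s'\<in>UNIV. \<mu> s a s' * v $ s')))"
proof -
  have "(1 - \<alpha>) * (\<gamma> \<bullet> v) = (\<Sum>s'\<in>UNIV. (1 - \<alpha>) * \<gamma> $ s' * v $ s')"
    by (simp add: inner_vec_def sum_distrib_left mult.assoc)
  also have "\<dots> = (\<Sum>s'\<in>UNIV. flow A \<alpha> \<mu> \<rho> s' * v $ s')"
    using \<rho> by (simp add: occupation_measures_def)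
  also have "\<dots> = (\<Sum>s'\<in>UNIV. \<Sum>x\<in>state_actions A.
      \<rho> $ x * ((if s' = fst x then 1 else 0) - \<alpha> * \<mu> (fst x) (snd x) s') * v $ s')"
    by (simp add: flow_def sum_distrib_right case_prod_unfold)
  also have "\<dots> = (\<Sum>x\<in>state_actions A. \<Sum>s'\<in>UNIV.
      \<rho> $ x * ((if s' = fst x then 1 else 0) - \<alpha> * \<mu> (fst x) (snd x) s') * v $ s')"
    by (rule sum.swap)
  also have "\<dots> = (\<Sum>x\<in>state_actions A. \<rho> $ x *
      (\<Sum>s'\<in>UNIV. (if s' = fst x then v $ s' else 0) - \<alpha> * (\<mu> (fst x) (snd x) s' * v $ s')))"
    unfolding sum_distrib_left by (intro sum.cong refl) (simp add: algebra_simps)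
  also have "\<dots> = (\<Sum>x\<in>state_actions A. \<rho> $ x *
      (v $ fst x - \<alpha> * (\<Sum>s'\<in>UNIV. \<mu> (fst x) (snd x) s' * v $ s')))"
    by (simp add: sum_subtractf sum_distrib_left)
  finally show ?thesis by (simp add: case_prod_unfold)
qed

section \<open>Exponential tail bound for sums of bounded centred variables\<close>

text \<open>On \<open>{a..b}\<close> the convex function \<open>x \<mapsto> exp (t * x)\<close> lies below its chord, and the expectation of the
affine chord at \<open>X\<close> is its value at the mean \<open>0\<close>. If \<open>a = b\<close>, the weight \<open>- a / (b - a)\<close> is \<open>0\<close>, and
both sides equal \<open>1\<close> because \<open>X\<close> is then constantly \<open>0\<close>.\<close>

lemma (in prob_space) mgf_chord_bound:
  fixes X :: "'a \<Rightarrow> real"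
  assumes X: "random_variable borel X"
    and bounds: "\<And>\<omega>. \<omega> \<in> space M \<Longrightarrow> a \<le> X \<omega> \<and> X \<omega> \<le> b"
    and mean: "expectation X = 0"
  shows "integrable M (\<lambda>\<omega>. exp (t * X \<omega>))"
    "expectation (\<lambda>\<omega>. exp (t * X \<omega>)) \<le>
       (- a / (b - a)) * exp (t * b) + (1 - - a / (b - a)) * exp (t * a)"
proof -
  have "exp (t * X \<omega>) \<le> exp (\<bar>t\<bar> * (\<bar>a\<bar> + \<bar>b\<bar>))" if "\<omega> \<in> space M" for \<omega>
  proof -
    have "t * X \<omega> \<le> \<bar>t\<bar> * \<bar>X \<omega>\<bar>" by (metis abs_ge_self abs_mult)
    also have "\<dots> \<le> \<bar>t\<bar> * (\<bar>a\<bar> + \<bar>b\<bar>)" using bounds[OF that] by (intro mult_left_mono) auto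
    finally show ?thesis by simp
  qed
  then show int: "integrable M (\<lambda>\<omega>. exp (t * X \<omega>))"
    using X by (intro integrable_const_bound[where B="exp (\<bar>t\<bar> * (\<bar>a\<bar> + \<bar>b\<bar>))"] AE_I2) auto
  have intX: "integrable M X"
    using X bounds by (intro integrable_const_bound[where B="\<bar>a\<bar> + \<bar>b\<bar>"] AE_I2) force+
  show "expectation (\<lambda>\<omega>. exp (t * X \<omega>)) \<le>
       (- a / (b - a)) * exp (t * b) + (1 - - a / (b - a)) * exp (t * a)"
  proof (cases "a = b")
    case True
    then have X_const: "X \<omega> = a" if "\<omega> \<in> space M" for \<omega> using bounds[OF that] by auto
    then have "expectation X = expectation (\<lambda>_. a)" by (intro Bochner_Integration.integral_cong) auto
    then have "a = 0" using mean by (simp add: prob_space)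
    moreover have "expectation (\<lambda>\<omega>. exp (t * X \<omega>)) = expectation (\<lambda>_. exp (t * a))"
      using X_const by (intro Bochner_Integration.integral_cong) auto
    ultimately show ?thesis using True by (simp add: prob_space)
  next
    case False
    with bounds not_empty have "a < b" by fastforce
    have chord: "exp (t * X \<omega>) \<le>
        (X \<omega> - a) / (b - a) * exp (t * b) + (b - X \<omega>) / (b - a) * exp (t * a)"
      if "\<omega> \<in> space M" for \<omega>
    proof -
      define q where "q = (X \<omega> - a) / (b - a)"
      have q: "0 \<le> q" "q \<le> 1" and q': "1 - q = (b - X \<omega>) / (b - a)"
        using bounds[OF that] \<open>a < b\<close> by (auto simp: q_def field_simps)
      have Xq: "X \<omega> = a + q * (b - a)" using \<open>a < b\<close> by (simp add: q_def)
      have "t * X \<omega> = (1 - q) *\<^sub>R (t * a) + q *\<^sub>R (t * b)"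
        unfolding Xq by (simp add: algebra_simps)
      then have "exp (t * X \<omega>) \<le> (1 - q) * exp (t * a) + q * exp (t * b)"
        using convex_onD[OF exp_convex q, of "t * a" "t * b"] by simp
      then show ?thesis unfolding q' by (simp add: q_def)
    qed
    have "expectation (\<lambda>\<omega>. exp (t * X \<omega>)) \<le> expectation (\<lambda>\<omega>.
        (X \<omega> - a) / (b - a) * exp (t * b) + (b - X \<omega>) / (b - a) * exp (t * a))"
      using int intX chord by (intro integral_mono) auto
    also have "\<dots> = (- a / (b - a)) * exp (t * b) + (b / (b - a)) * exp (t * a)"
      using intX by (simp add: mean prob_space)
    also have "b / (b - a) = 1 - - a / (b - a)" using \<open>a < b\<close> by (simp add: field_simps)
    finally show ?thesis .
  qed
qed

text \<open>The exponential Markov inequality; independence turns the moment generating function of the sum into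
a product, and each factor is bounded by the chord.\<close>

lemma (in prob_space) chernoff_chord_bound:
  fixes X :: "'i \<Rightarrow> 'a \<Rightarrow> real"
  assumes "finite I" and indep: "indep_vars (\<lambda>_. borel) X I"
    and bounds: "\<And>i \<omega>. i \<in> I \<Longrightarrow> \<omega> \<in> space M \<Longrightarrow> a i \<le> X i \<omega> \<and> X i \<omega> \<le> b i"
    and mean: "\<And>i. i \<in> I \<Longrightarrow> expectation (X i) = 0"
    and h: "0 < h"
  shows "prob {\<omega> \<in> space M. r \<le> (\<Sum>i\<in>I. w i * X i \<omega>)} \<le> exp (- h * r) *
    (\<Prod>i\<in>I. (- a i / (b i - a i)) * exp (h * w i * b i) +
             (1 - - a i / (b i - a i)) * exp (h * w i * a i))"
proof -
  have rv: "random_variable borel (X i)" if "i \<in> I" for i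
    using indep that by (auto simp: indep_vars_def)
  note mgf = mgf_chord_bound[OF rv bounds mean]
  have indep_exp: "indep_vars (\<lambda>_. borel) (\<lambda>i \<omega>. exp (h * w i * X i \<omega>)) I"
    by (rule indep_vars_compose2[OF indep]) auto
  have exp_sum: "exp (h * (\<Sum>i\<in>I. w i * X i \<omega>)) = (\<Prod>i\<in>I. exp (h * w i * X i \<omega>))" for \<omega>
    using \<open>finite I\<close> by (simp add: sum_distrib_left exp_sum mult.assoc)
  have "integrable M (\<lambda>\<omega>. \<Prod>i\<in>I. exp (h * w i * X i \<omega>))"
    using \<open>finite I\<close> indep_exp mgf(1) by (intro indep_vars_integrable) auto
  then have int: "set_integrable M (space M) (\<lambda>\<omega>. exp (h * (\<Sum>i\<in>I. w i * X i \<omega>)))"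
    unfolding exp_sum set_integrable_def
    by (subst Bochner_Integration.integrable_cong[OF refl]) auto
  have "prob {\<omega> \<in> space M. r \<le> (\<Sum>i\<in>I. w i * X i \<omega>)}
      \<le> exp (- h * r) * (LINT \<omega>:space M|M. exp (h * (\<Sum>i\<in>I. w i * X i \<omega>)))"
    by (rule Chernoff_ineq_ge[OF h int]) auto
  also have "(LINT \<omega>:space M|M. exp (h * (\<Sum>i\<in>I. w i * X i \<omega>)))
      = expectation (\<lambda>\<omega>. \<Prod>i\<in>I. exp (h * w i * X i \<omega>))"
    unfolding exp_sum set_lebesgue_integral_def
    by (rule Bochner_Integration.integral_cong) auto
  also have "\<dots> = (\<Prod>i\<in>I. expectation (\<lambda>\<omega>. exp (h * w i * X i \<omega>)))"
    using \<open>finite I\<close> indep_exp mgf(1) by (intro indep_vars_lebesgue_integral) auto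
  also have "exp (- h * r) * \<dots> \<le> exp (- h * r) *
    (\<Prod>i\<in>I. (- a i / (b i - a i)) * exp (h * w i * b i) +
             (1 - - a i / (b i - a i)) * exp (h * w i * a i))"
    by (intro mult_left_mono prod_mono conjI mgf(2) integral_nonneg) auto
  finally show ?thesis .
qed

section \<open>Log-sum-exp constraints and their convexity\<close>

lemma convex_on_linear:
  fixes f :: "'v::real_vector \<Rightarrow> real"
  assumes "linear f" shows "convex_on UNIV f"
  using assms by (auto simp: convex_on_def linear_add linear_cmul)

text \<open>Write \<open>S x\<close> for the argument of the logarithm. The claim is \<open>S z \<le> S x powr (1 - t) * S y powr t\<close>
for \<open>z\<close> between \<open>x\<close> and \<open>y\<close>, a form of Hoelder's inequality. After division by the right-hand side,
convexity of \<open>exp\<close> bounds the two terms of \<open>S z\<close> separately by means of the normalized terms of \<open>S x\<close> and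
\<open>S y\<close>, and these normalized terms add up to \<open>1\<close>.\<close>

lemma convex_on_ln_sum_exp:
  fixes f g :: "'v::real_vector \<Rightarrow> real"
  assumes f: "linear f" and g: "linear g" and q: "0 \<le> q" "q \<le> 1"
  shows "convex_on UNIV (\<lambda>x. ln (q * exp (f x) + (1 - q) * exp (g x)))"
proof (rule convex_onI)
  fix t :: real and x y :: 'v
  assume t: "0 < t" "t < 1"
  define S where "S x = q * exp (f x) + (1 - q) * exp (g x)" for x
  have S_pos: "0 < S x" for x
    using q by (cases "q = 0") (auto simp: S_def intro: add_pos_nonneg)
  \<comment> \<open>\<open>exp m\<close> is the weighted geometric mean of \<open>S x\<close> and \<open>S y\<close>, the bound to be shown for \<open>S z\<close>.\<close>
  define m where "m = (1 - t) * ln (S x) + t * ln (S y)"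
  have tangent: "exp ((1 - t) * b + t * c - m) \<le> (1 - t) * (exp b / S x) + t * (exp c / S y)" for b c
  proof -
    have "(1 - t) * b + t * c - m = (1 - t) *\<^sub>R (b - ln (S x)) + t *\<^sub>R (c - ln (S y))"
      by (simp add: m_def algebra_simps)
    then have "exp ((1 - t) * b + t * c - m)
        \<le> (1 - t) * exp (b - ln (S x)) + t * exp (c - ln (S y))"
      using convex_onD[OF exp_convex, of t "b - ln (S x)" "c - ln (S y)"] t by simp
    then show ?thesis using S_pos by (simp add: exp_diff)
  qed
  let ?z = "(1 - t) *\<^sub>R x + t *\<^sub>R y"
  have fz: "f ?z = (1 - t) * f x + t * f y" and gz: "g ?z = (1 - t) * g x + t * g y"
    using f g by (simp_all add: linear_add linear_cmul)
  have "S ?z * exp (- m) = q * exp (f ?z - m) + (1 - q) * exp (g ?z - m)"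
    by (simp add: S_def algebra_simps exp_diff exp_minus divide_inverse)
  also have "\<dots> \<le> q * ((1 - t) * (exp (f x) / S x) + t * (exp (f y) / S y)) +
      (1 - q) * ((1 - t) * (exp (g x) / S x) + t * (exp (g y) / S y))"
    unfolding fz gz using q by (intro add_mono mult_left_mono tangent) auto
  also have "\<dots> = (1 - t) * ((q * exp (f x) + (1 - q) * exp (g x)) / S x)
      + t * ((q * exp (f y) + (1 - q) * exp (g y)) / S y)"
    by (simp add: add_divide_distrib algebra_simps diff_divide_distrib)
  also have "\<dots> = 1" using S_pos[of x] S_pos[of y] by (simp flip: S_def)
  finally have "S ?z \<le> exp m" by (simp add: exp_minus divide_simps)
  then have "ln (S ?z) \<le> m" using S_pos[of ?z] ln_le_cancel_iff[of "S ?z" "exp m"] by simp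
  then show "ln (q * exp (f ?z) + (1 - q) * exp (g ?z)) \<le>
      (1 - t) * ln (q * exp (f x) + (1 - q) * exp (g x)) + t * ln (q * exp (f y) + (1 - q) * exp (g y))"
    by (simp add: S_def m_def)
qed simp

lemma mixing_coeff_bounds:
  assumes W: "\<And>s'. 0 \<le> W s'" and \<zeta>: "\<And>s a s'. a \<in> A s \<Longrightarrow> 0 \<le> \<zeta>u s a s' \<and> \<zeta>l s a s' \<le> 0"
    and a: "a \<in> A s"
  shows "0 \<le> mixing_coeff W s0 \<zeta>l \<zeta>u s a" "mixing_coeff W s0 \<zeta>l \<zeta>u s a \<le> 1"
proof -
  let ?L = "\<Sum>s'\<in>UNIV - {s0}. W s' * \<zeta>l s a s'" and ?U = "\<Sum>s'\<in>UNIV - {s0}. W s' * \<zeta>u s a s'"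
  have "?L \<le> 0" "0 \<le> ?U"
    using W \<zeta>[OF a] by (auto intro!: sum_nonpos sum_nonneg mult_nonneg_nonpos)
  moreover have "mixing_coeff W s0 \<zeta>l \<zeta>u s a = - ?L / (?U - ?L)"
    by (simp add: mixing_coeff_def right_diff_distrib sum_subtractf)
  moreover have "0 \<le> - L / (U - L) \<and> - L / (U - L) \<le> 1" if "L \<le> 0" "0 \<le> U" for L U :: real
    using that by (simp only: zero_le_divide_iff divide_le_eq_1) linarith
  ultimately show "0 \<le> mixing_coeff W s0 \<zeta>l \<zeta>u s a" "mixing_coeff W s0 \<zeta>l \<zeta>u s a \<le> 1"
    by simp_all
qed

text \<open>Undoing the logarithms requires positive arguments, which holds since the mixing coefficient is a
weight in \<open>[0, 1]\<close>.\<close>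

lemma exp_log_mgf_bound:
  fixes A :: "'s::finite \<Rightarrow> 'a::finite set"
  assumes W: "\<And>s'. 0 \<le> W s'" and \<zeta>: "\<And>s a s'. a \<in> A s \<Longrightarrow> 0 \<le> \<zeta>u s a s' \<and> \<zeta>l s a s' \<le> 0"
  shows "exp (log_mgf_bound A W s0 \<zeta>l \<zeta>u h \<rho>) = (\<Prod>(s, a)\<in>state_actions A.
        mixing_coeff W s0 \<zeta>l \<zeta>u s a *
          exp (h * \<rho> $ (s, a) * (\<Sum>s'\<in>UNIV - {s0}. W s' * \<zeta>u s a s')) +
        (1 - mixing_coeff W s0 \<zeta>l \<zeta>u s a) *
          exp (h * \<rho> $ (s, a) * (\<Sum>s'\<in>UNIV - {s0}. W s' * \<zeta>l s a s')))"
proof -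
  have "0 < q * exp x + (1 - q) * exp y" if "0 \<le> q" "q \<le> 1" for q x y :: real
    using that by (cases "q = 0") (auto intro: add_pos_nonneg)
  then show ?thesis
    unfolding log_mgf_bound_def exp_sum[OF finite_state_actions]
    using mixing_coeff_bounds[of W A \<zeta>u \<zeta>l, OF W \<zeta>]
    by (intro prod.cong refl) (auto simp: state_actions_def)
qed

lemma convex_on_log_mgf_bound:
  fixes A :: "'s::finite \<Rightarrow> 'a::finite set"
  assumes W: "\<And>s'. 0 \<le> W s'" and \<zeta>: "\<And>s a s'. a \<in> A s \<Longrightarrow> 0 \<le> \<zeta>u s a s' \<and> \<zeta>l s a s' \<le> 0"
  shows "convex_on UNIV (\<lambda>x :: real \<times> (real ^ ('s \<times> 'a)). log_mgf_bound A W s0 \<zeta>l \<zeta>u h (snd x))"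
proof -
  have lin: "linear (\<lambda>x :: real \<times> (real ^ ('s \<times> 'a)). h * snd x $ y * b)" for y b
    by (rule linearI) (simp_all add: algebra_simps)
  have "convex_on UNIV (\<lambda>x :: real \<times> (real ^ ('s \<times> 'a)). \<Sum>y\<in>F. case y of (s, a) \<Rightarrow> ln (
        mixing_coeff W s0 \<zeta>l \<zeta>u s a *
          exp (h * snd x $ (s, a) * (\<Sum>s'\<in>UNIV - {s0}. W s' * \<zeta>u s a s')) +
        (1 - mixing_coeff W s0 \<zeta>l \<zeta>u s a) *
          exp (h * snd x $ (s, a) * (\<Sum>s'\<in>UNIV - {s0}. W s' * \<zeta>l s a s'))))"
    if "F \<subseteq> state_actions A" for F
    using finite_subset[OF that finite_state_actions] that
  proof (induction F rule: finite_induct)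
    case empty
    then show ?case by (simp add: convex_on_const)
  next
    case (insert y F)
    obtain s a where y: "y = (s, a)" "a \<in> A s"
      using insert.prems by (auto simp: state_actions_def)
    show ?case
      using insert mixing_coeff_bounds[of W A \<zeta>u \<zeta>l, OF W \<zeta> y(2)]
      by (auto simp: y(1) intro!: convex_on_add convex_on_ln_sum_exp lin)
  qed
  then show ?thesis unfolding log_mgf_bound_def by simp
qed

text \<open>The factor \<open>b\<close> covers both kinds of constraints: the threshold is the variable \<open>z\<close> in the cost
constraint (\<open>b = 1\<close>), while in the constraints with a constant threshold only \<open>\<rho>\<close> varies (\<open>b = 0\<close>).\<close>

lemma linear_residual:
  fixes A :: "'s::finite \<Rightarrow> 'a::finite set"
  shows "linear (\<lambda>x. residual A \<alpha> u l \<zeta>l (b * fst x) (snd x))"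
  by (rule linearI)
    (simp_all add: residual_def case_prod_unfold algebra_simps sum.distrib sum_subtractf
      sum_distrib_left add_divide_distrib diff_divide_distrib)

lemma linear_flow:
  fixes A :: "'s::finite \<Rightarrow> 'a::finite set"
  shows "linear (\<lambda>x. flow A \<alpha> \<mu> (snd x) s')"
  by (rule linearI) (simp_all add: flow_def case_prod_unfold distrib_right sum.distrib sum_distrib_left mult.assoc)

lemma convex_on_chance_surrogate:
  fixes A :: "'s::finite \<Rightarrow> 'a::finite set"
  assumes W: "\<And>s'. 0 \<le> W s'" and \<zeta>: "\<And>s a s'. a \<in> A s \<Longrightarrow> 0 \<le> \<zeta>u s a s' \<and> \<zeta>l s a s' \<le> 0"
  shows "convex_on UNIV (\<lambda>x. log_mgf_bound A W s0 \<zeta>l \<zeta>u h (snd x)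
           - (e + h * residual A \<alpha> u l \<zeta>l (b * fst x + \<xi>) (snd x)))"
proof -
  have "linear (\<lambda>x. - h * residual A \<alpha> u l \<zeta>l (b * fst x) (snd x))"
    using linear_compose_scale_right[OF linear_residual, of "- h" A \<alpha> u l \<zeta>l b] by simp
  then have "convex_on UNIV (\<lambda>x. (log_mgf_bound A W s0 \<zeta>l \<zeta>u h (snd x)
      + - h * residual A \<alpha> u l \<zeta>l (b * fst x) (snd x)) + (- e - h * \<xi> / \<alpha>))"
    by (intro convex_on_add convex_on_log_mgf_bound convex_on_linear W \<zeta> convex_on_const[THEN iffD2] convex_UNIV)
  moreover have "residual A \<alpha> u l \<zeta>l (b * fst x + \<xi>) (snd x)
      = residual A \<alpha> u l \<zeta>l (b * fst x) (snd x) + \<xi> / \<alpha>" for x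
    by (simp add: residual_def add_divide_distrib diff_divide_distrib)
  ultimately show ?thesis by (simp add: algebra_simps)
qed

lemma convex_program_surrogate:
  fixes A :: "'s::finite \<Rightarrow> 'a::finite set"
  assumes \<zeta>: "\<And>s a s'. a \<in> A s \<Longrightarrow> 0 \<le> \<zeta>u s a s' \<and> \<zeta>l s a s' \<le> 0"
    and sc: "\<And>s'. cost_max A \<alpha> cu sc \<le> cost_max A \<alpha> cu s'"
    and sd: "\<And>k s'. k \<in> {1..K} \<Longrightarrow> cost_max A \<alpha> (du k) (sd k) \<le> cost_max A \<alpha> (du k) s'"
  shows "convex_program (surrogate_program A \<alpha> \<gamma> \<mu> \<zeta>l \<zeta>u cl cu dl du K \<xi> p0 p1 sc sd h0 h)"
proof -
  have "linear (\<lambda>x :: real \<times> (real ^ ('s \<times> 'a)). - (snd x $ y))"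
    "linear (\<lambda>x :: real \<times> (real ^ ('s \<times> 'a)). snd x $ y)" for y
    by (rule linearI; simp)+
  moreover have "convex_on UNIV (\<lambda>x :: real \<times> (real ^ ('s \<times> 'a)). log_mgf_bound A (cost_excess A \<alpha> cu sc) sc \<zeta>l \<zeta>u h0 (snd x)
      - (ln (1 - p0) + h0 * residual A \<alpha> cu cl \<zeta>l (fst x) (snd x)))"
    using convex_on_chance_surrogate[where b=1 and \<xi>=0 and \<zeta>u=\<zeta>u and \<zeta>l=\<zeta>l and W="cost_excess A \<alpha> cu sc" and A=A, OF _ \<zeta>] sc
    by (simp add: cost_excess_def)
  moreover have "convex_on UNIV (\<lambda>x :: real \<times> (real ^ ('s \<times> 'a)). log_mgf_bound A (cost_excess A \<alpha> (du k) (sd k)) (sd k) \<zeta>l \<zeta>u (h k) (snd x)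
      - (ln ((1 - p1) / real K) + h k * residual A \<alpha> (du k) (dl k) \<zeta>l (\<xi> k) (snd x)))"
    if "k \<in> {1..K}" for k
    using convex_on_chance_surrogate[where b=0 and \<zeta>u=\<zeta>u and \<zeta>l=\<zeta>l and W="cost_excess A \<alpha> (du k) (sd k)" and A=A, OF _ \<zeta>] sd[OF that]
    by (simp add: cost_excess_def)
  ultimately show ?thesis
    unfolding convex_program_def surrogate_program_def
    by (auto simp: case_prod_unfold linear_fst linear_flow)
qed

section \<open>Random transition probabilities\<close>

text \<open>The hypotheses on the transition law alone. They are shared by the estimates for the running cost
and for each constraint cost, so that one tail bound serves all of these.\<close>

locale uncertain_mdp = prob_space M
  for M :: "'w measure" +
  fixes A :: "'s::finite \<Rightarrow> 'a::finite set"
    and \<alpha> :: real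
    and p \<zeta> :: "'s \<Rightarrow> 'a \<Rightarrow> 's \<Rightarrow> 'w \<Rightarrow> real"
    and \<mu> \<zeta>l \<zeta>u :: "'s \<Rightarrow> 'a \<Rightarrow> 's \<Rightarrow> real"
  assumes actions: "\<And>s. A s \<noteq> {}"
    and discount: "0 < \<alpha>" "\<alpha> < 1"
    and p_meas: "\<And>s a s'. a \<in> A s \<Longrightarrow> p s a s' \<in> borel_measurable M"
    and p_distr: "\<And>s a s' \<omega>. a \<in> A s \<Longrightarrow> \<omega> \<in> space M \<Longrightarrow> 0 \<le> p s a s' \<omega>"
                 "\<And>s a \<omega>. a \<in> A s \<Longrightarrow> \<omega> \<in> space M \<Longrightarrow> (\<Sum>s'\<in>UNIV. p s a s' \<omega>) = 1"
    and \<mu>_mean: "\<And>s a s'. a \<in> A s \<Longrightarrow> \<mu> s a s' = expectation (p s a s')"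
    and \<mu>_sum: "\<And>s a. a \<in> A s \<Longrightarrow> (\<Sum>s'\<in>UNIV. \<mu> s a s') = 1"
    and p_decomp: "\<And>s a s' \<omega>. a \<in> A s \<Longrightarrow> \<omega> \<in> space M \<Longrightarrow> p s a s' \<omega> = \<mu> s a s' + \<zeta> s a s' \<omega>"
    and \<zeta>_bounds: "\<And>s a s' \<omega>. a \<in> A s \<Longrightarrow> \<omega> \<in> space M \<Longrightarrow>
                     \<zeta>l s a s' \<le> \<zeta> s a s' \<omega> \<and> \<zeta> s a s' \<omega> \<le> \<zeta>u s a s'"
    and \<zeta>_signs: "\<And>s a s'. a \<in> A s \<Longrightarrow> 0 \<le> \<zeta>u s a s' \<and> \<zeta>l s a s' \<le> 0"
    and \<zeta>_indep: "indep_vars (\<lambda>_. borel :: (real ^ 's) measure)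
                     (\<lambda>(s, a) \<omega>. \<chi> s'. \<zeta> s a s' \<omega>) (state_actions A)"
begin

lemma policy_matrix_stochastic:
  assumes f: "f \<in> stationary_policies A" and \<omega>: "\<omega> \<in> space M"
  shows "0 \<le> policy_matrix A p f \<omega> $ s $ t" "(\<Sum>t\<in>UNIV. policy_matrix A p f \<omega> $ s $ t) = 1"
proof -
  show "0 \<le> policy_matrix A p f \<omega> $ s $ t"
    using f p_distr(1) \<omega> by (auto simp: policy_matrix_def stationary_policies_def intro!: sum_nonneg)
  have "(\<Sum>t\<in>UNIV. policy_matrix A p f \<omega> $ s $ t) = (\<Sum>a\<in>A s. f s a * (\<Sum>t\<in>UNIV. p s a t \<omega>))"
    unfolding policy_matrix_def sum_distrib_left by (simp, rule sum.swap)
  also have "\<dots> = 1"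
    using f p_distr(2) \<omega> by (simp add: stationary_policies_def)
  finally show "(\<Sum>t\<in>UNIV. policy_matrix A p f \<omega> $ s $ t) = 1" .
qed

definition policy_value :: "('s \<Rightarrow> 'a \<Rightarrow> 'w \<Rightarrow> real) \<Rightarrow> ('s \<Rightarrow> 'a \<Rightarrow> real) \<Rightarrow> 'w \<Rightarrow> real ^ 's" where
  "policy_value c f \<omega> = matrix_inv (mat 1 - \<alpha> *\<^sub>R policy_matrix A p f \<omega>) *v policy_cost A c f \<omega>"

lemma policy_value_equation:
  assumes f: "f \<in> stationary_policies A" and \<omega>: "\<omega> \<in> space M"
  shows "policy_value c f \<omega> = policy_cost A c f \<omega> + \<alpha> *\<^sub>R (policy_matrix A p f \<omega> *v policy_value c f \<omega>)"
proof -
  have "(mat 1 - \<alpha> *\<^sub>R policy_matrix A p f \<omega>) *v policy_value c f \<omega> = policy_cost A c f \<omega>"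
    unfolding policy_value_def
    by (intro matrix_inv_solves det_discounted_nonzero policy_matrix_stochastic f \<omega> discount)
  then show ?thesis
    by (simp add: matrix_vector_mult_diff_rdistrib scaleR_matrix_vector_assoc diff_eq_eq)
qed

text \<open>Without measurability, \<open>measure\<close> of the events in the chance constraints would be \<open>0\<close> by default.\<close>

lemma borel_measurable_discounted_cost:
  assumes f: "f \<in> stationary_policies A"
    and c: "\<And>s a. a \<in> A s \<Longrightarrow> c s a \<in> borel_measurable M"
  shows "discounted_cost A \<alpha> \<gamma> p c f \<in> borel_measurable M"
proof -
  have P: "(\<lambda>\<omega>. policy_matrix A p f \<omega> $ s $ t) \<in> borel_measurable M" for s t
    unfolding policy_matrix_def using p_meas by simp
  then have B: "(\<lambda>\<omega>. (mat 1 - \<alpha> *\<^sub>R policy_matrix A p f \<omega>) $ s $ t) \<in> borel_measurable M" for s t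
    by simp
  have g: "(\<lambda>\<omega>. policy_cost A c f \<omega> $ s) \<in> borel_measurable M" for s
    unfolding policy_cost_def using c by simp
  have "(\<lambda>\<omega>. policy_value c f \<omega> $ s) \<in> borel_measurable M" for s
    unfolding policy_value_def
    by (intro borel_measurable_matrix_inv_mult B g det_discounted_nonzero
        policy_matrix_stochastic f discount)
  then show ?thesis
    unfolding discounted_cost_def[abs_def] policy_value_def[symmetric] inner_vec_def by simp
qed

lemma policy_value_bounds:
  assumes f: "f \<in> stationary_policies A" and \<omega>: "\<omega> \<in> space M"
    and c: "\<And>s a. a \<in> A s \<Longrightarrow> l s a \<le> c s a \<omega> \<and> c s a \<omega> \<le> u s a"
  shows "cost_min A \<alpha> l s \<le> policy_value c f \<omega> $ s" "policy_value c f \<omega> $ s \<le> cost_max A \<alpha> u s"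
proof -
  let ?U = "Max ((\<lambda>(s', a). u s' a) ` state_actions A)"
  let ?L = "Min ((\<lambda>(s', a). l s' a) ` state_actions A)"
  have f_nonneg: "0 \<le> f s a" if "a \<in> A s" for s a
    using f that by (auto simp: stationary_policies_def)
  have f_sum: "(\<Sum>a\<in>A s. f s a) = 1" for s
    using f by (auto simp: stationary_policies_def)
  have le: "policy_cost A c f \<omega> $ s \<le> b" if "\<And>a. a \<in> A s \<Longrightarrow> u s a \<le> b" for s b
  proof -
    have "policy_cost A c f \<omega> $ s \<le> (\<Sum>a\<in>A s. f s a * b)"
      unfolding policy_cost_def using c that f_nonneg
      by (auto intro!: sum_mono mult_left_mono intro: order_trans)
    then show ?thesis by (simp add: f_sum flip: sum_distrib_right)
  qed
  have ge: "b \<le> policy_cost A c f \<omega> $ s" if "\<And>a. a \<in> A s \<Longrightarrow> b \<le> l s a" for s b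
  proof -
    have "(\<Sum>a\<in>A s. f s a * b) \<le> policy_cost A c f \<omega> $ s"
      unfolding policy_cost_def using c that f_nonneg
      by (auto intro!: sum_mono mult_left_mono intro: order_trans)
    then show ?thesis by (simp add: f_sum flip: sum_distrib_right)
  qed
  have U: "u s a \<le> ?U" and L: "?L \<le> l s a" if "a \<in> A s" for s a
    using that by (auto simp: state_actions_def intro!: Max_ge Min_le)
  have "policy_value c f \<omega> $ s \<le> policy_cost A c f \<omega> $ s + \<alpha> / (1 - \<alpha>) * ?U"
    by (intro discounted_value_le[OF _ _ discount policy_value_equation] policy_matrix_stochastic f \<omega> le U)
  also have "\<dots> \<le> cost_max A \<alpha> u s"
    unfolding cost_max_def by (intro add_right_mono le) simp
  finally show "policy_value c f \<omega> $ s \<le> cost_max A \<alpha> u s" .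
  have "cost_min A \<alpha> l s \<le> policy_cost A c f \<omega> $ s + \<alpha> / (1 - \<alpha>) * ?L"
    unfolding cost_min_def by (intro add_right_mono ge) simp
  also have "\<dots> \<le> policy_value c f \<omega> $ s"
    by (intro discounted_value_ge[OF _ _ discount policy_value_equation] policy_matrix_stochastic f \<omega> ge L)
  finally show "cost_min A \<alpha> l s \<le> policy_value c f \<omega> $ s" .
qed

text \<open>Pairing \<open>\<rho>\<close> with the value vector gives \<open>v(s) - \<alpha> \<Sum> \<mu> v\<close>, whereas the fixed point equation, weighted by
the mass of \<open>\<rho>\<close> in \<open>s\<close>, turns \<open>v(s)\<close> into \<open>c + \<alpha> \<Sum> p v\<close>. The difference \<open>p - \<mu>\<close> is the noise \<open>\<zeta>\<close>.\<close>

lemma discounted_cost_occupation: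
  assumes f: "f \<in> stationary_policies A" and \<omega>: "\<omega> \<in> space M"
    and \<rho>: "\<rho> \<in> occupation_measures A \<alpha> \<mu> \<gamma>"
    and \<rho>f: "\<And>s a. a \<in> A s \<Longrightarrow> \<rho> $ (s, a) = (\<Sum>b\<in>A s. \<rho> $ (s, b)) * f s a"
  shows "discounted_cost A \<alpha> \<gamma> p c f \<omega> = (\<Sum>(s, a)\<in>state_actions A.
    \<rho> $ (s, a) * (c s a \<omega> + \<alpha> * (\<Sum>s'\<in>UNIV. \<zeta> s a s' \<omega> * policy_value c f \<omega> $ s')))"
proof -
  define v where "v = policy_value c f \<omega>"
  have state: "(\<Sum>a\<in>A s. \<rho> $ (s, a) * (v $ s - \<alpha> * (\<Sum>s'\<in>UNIV. \<mu> s a s' * v $ s'))) =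
      (\<Sum>a\<in>A s. \<rho> $ (s, a) * (c s a \<omega> + \<alpha> * (\<Sum>s'\<in>UNIV. \<zeta> s a s' \<omega> * v $ s')))" for s
  proof -
    let ?r = "\<Sum>b\<in>A s. \<rho> $ (s, b)"
    have "v $ s = (\<Sum>a\<in>A s. f s a * c s a \<omega>) + \<alpha> * (\<Sum>s'\<in>UNIV. (\<Sum>a\<in>A s. f s a * p s a s' \<omega>) * v $ s')"
      using arg_cong[OF policy_value_equation[OF f \<omega>, of c], of "\<lambda>x. x $ s"]
      by (simp add: v_def policy_cost_def policy_matrix_def matrix_vector_mult_def)
    also have "(\<Sum>s'\<in>UNIV. (\<Sum>a\<in>A s. f s a * p s a s' \<omega>) * v $ s') =
        (\<Sum>a\<in>A s. f s a * (\<Sum>s'\<in>UNIV. p s a s' \<omega> * v $ s'))"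
      unfolding sum_distrib_left sum_distrib_right by (subst sum.swap) (simp add: mult.assoc)
    finally have "v $ s = (\<Sum>a\<in>A s. f s a * (c s a \<omega> + \<alpha> * (\<Sum>s'\<in>UNIV. p s a s' \<omega> * v $ s')))"
      by (simp add: distrib_left sum.distrib sum_distrib_left mult.left_commute)
    then have "?r * v $ s = ?r * \<dots>" by (rule arg_cong)
    also have "\<dots> = (\<Sum>a\<in>A s. \<rho> $ (s, a) * (c s a \<omega> + \<alpha> * (\<Sum>s'\<in>UNIV. p s a s' \<omega> * v $ s')))"
      unfolding sum_distrib_left[of ?r] mult.assoc[symmetric] by (intro sum.cong refl) (simp add: \<rho>f[symmetric])
    finally have rv: "?r * v $ s = \<dots>" .
    have "(\<Sum>a\<in>A s. \<rho> $ (s, a) * (v $ s - \<alpha> * (\<Sum>s'\<in>UNIV. \<mu> s a s' * v $ s'))) =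
        ?r * v $ s - (\<Sum>a\<in>A s. \<rho> $ (s, a) * (\<alpha> * (\<Sum>s'\<in>UNIV. \<mu> s a s' * v $ s')))"
      by (simp add: right_diff_distrib sum_subtractf sum_distrib_right)
    also have "\<dots> = (\<Sum>a\<in>A s. \<rho> $ (s, a) * (c s a \<omega> + \<alpha> * (\<Sum>s'\<in>UNIV. p s a s' \<omega> * v $ s'))
        - \<rho> $ (s, a) * (\<alpha> * (\<Sum>s'\<in>UNIV. \<mu> s a s' * v $ s')))"
      unfolding rv sum_subtractf ..
    also have "\<dots> = (\<Sum>a\<in>A s. \<rho> $ (s, a) * (c s a \<omega> + \<alpha> * (\<Sum>s'\<in>UNIV. \<zeta> s a s' \<omega> * v $ s')))"
    proof (intro sum.cong refl)
      fix a assume "a \<in> A s"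
      then have "(\<Sum>s'\<in>UNIV. p s a s' \<omega> * v $ s') =
          (\<Sum>s'\<in>UNIV. \<mu> s a s' * v $ s') + (\<Sum>s'\<in>UNIV. \<zeta> s a s' \<omega> * v $ s')"
        using p_decomp \<omega> by (simp add: distrib_right sum.distrib)
      then show "\<rho> $ (s, a) * (c s a \<omega> + \<alpha> * (\<Sum>s'\<in>UNIV. p s a s' \<omega> * v $ s'))
        - \<rho> $ (s, a) * (\<alpha> * (\<Sum>s'\<in>UNIV. \<mu> s a s' * v $ s')) =
        \<rho> $ (s, a) * (c s a \<omega> + \<alpha> * (\<Sum>s'\<in>UNIV. \<zeta> s a s' \<omega> * v $ s'))"
        by (simp only:) (simp add: algebra_simps)
    qed
    finally show ?thesis .
  qed
  have "discounted_cost A \<alpha> \<gamma> p c f \<omega> = (1 - \<alpha>) * (\<gamma> \<bullet> v)"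
    by (simp add: discounted_cost_def v_def policy_value_def)
  then show ?thesis
    unfolding occupation_measure_pairing[OF \<rho>] sum_state_actions state v_def[symmetric] .
qed

text \<open>The state-action pair is a single argument, so that \<open>perturbation W s0\<close> is a family of random variables
indexed by pairs.\<close>

definition perturbation :: "('s \<Rightarrow> real) \<Rightarrow> 's \<Rightarrow> 's \<times> 'a \<Rightarrow> 'w \<Rightarrow> real" where
  "perturbation W s0 x \<omega> = (\<Sum>s'\<in>UNIV - {s0}. W s' * \<zeta> (fst x) (snd x) s' \<omega>)"

lemma sum_\<zeta>:
  assumes "a \<in> A s" "\<omega> \<in> space M"
  shows "(\<Sum>s'\<in>UNIV. \<zeta> s a s' \<omega>) = 0"
  using p_distr(2)[OF assms] \<mu>_sum[OF assms(1)] p_decomp[OF assms] by (simp add: sum.distrib)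

text \<open>Since \<open>\<zeta> - \<zeta>l \<ge> 0 \<ge> \<zeta>l\<close>, the product \<open>\<zeta> v = (\<zeta> - \<zeta>l) v + \<zeta>l v\<close> grows if \<open>v\<close> is replaced by its upper bound in
the first term and by its lower bound in the second. In the random part \<open>\<Sum> \<zeta> cost_max\<close> of the result
\<open>cost_max\<close> may be shifted by a constant, as the noise sums to \<open>0\<close> over the successor states; shifting by
its value at \<open>s0\<close> removes \<open>s0\<close> from the sum and leaves the weights \<open>cost_excess\<close>.\<close>

lemma discounted_cost_le:
  assumes f: "f \<in> stationary_policies A" and \<omega>: "\<omega> \<in> space M"
    and \<rho>: "\<rho> \<in> occupation_measures A \<alpha> \<mu> \<gamma>"
    and \<rho>f: "\<And>s a. a \<in> A s \<Longrightarrow> \<rho> $ (s, a) = (\<Sum>b\<in>A s. \<rho> $ (s, b)) * f s a"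
    and c: "\<And>s a. a \<in> A s \<Longrightarrow> l s a \<le> c s a \<omega> \<and> c s a \<omega> \<le> u s a"
    and X: "(\<Sum>x\<in>state_actions A. \<rho> $ x * perturbation (cost_excess A \<alpha> u s0) s0 x \<omega>)
              \<le> residual A \<alpha> u l \<zeta>l t \<rho>"
  shows "discounted_cost A \<alpha> \<gamma> p c f \<omega> \<le> t"
proof -
  define v where "v = policy_value c f \<omega>"
  let ?hi = "cost_max A \<alpha> u" and ?lo = "cost_min A \<alpha> l"
  define Y where "Y x = perturbation (cost_excess A \<alpha> u s0) s0 x \<omega>" for x
  define Z where "Z s a = (\<Sum>s'\<in>UNIV. (?hi s' - ?lo s') * \<zeta>l s a s')" for s a
  have v: "?lo s \<le> v $ s" "v $ s \<le> ?hi s" for s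
    unfolding v_def using policy_value_bounds[OF f \<omega>, of l c u] c by auto
  have noise: "(\<Sum>s'\<in>UNIV. \<zeta> s a s' \<omega> * v $ s') \<le> Y (s, a) - Z s a" if a: "a \<in> A s" for s a
  proof -
    have "\<zeta> s a s' \<omega> * v $ s' \<le>
        cost_excess A \<alpha> u s0 s' * \<zeta> s a s' \<omega> + ?hi s0 * \<zeta> s a s' \<omega> - (?hi s' - ?lo s') * \<zeta>l s a s'" for s'
    proof -
      have "(\<zeta> s a s' \<omega> - \<zeta>l s a s') * v $ s' \<le> (\<zeta> s a s' \<omega> - \<zeta>l s a s') * ?hi s'"
        using v \<zeta>_bounds[OF a \<omega>, of s'] by (intro mult_left_mono) auto
      moreover have "\<zeta>l s a s' * v $ s' \<le> \<zeta>l s a s' * ?lo s'"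
        using v \<zeta>_signs[OF a, of s'] by (intro mult_left_mono_neg) auto
      ultimately show ?thesis by (simp add: cost_excess_def algebra_simps)
    qed
    then have "(\<Sum>s'\<in>UNIV. \<zeta> s a s' \<omega> * v $ s') \<le> (\<Sum>s'\<in>UNIV.
        cost_excess A \<alpha> u s0 s' * \<zeta> s a s' \<omega> + ?hi s0 * \<zeta> s a s' \<omega> - (?hi s' - ?lo s') * \<zeta>l s a s')"
      by (rule sum_mono)
    also have "\<dots> = (\<Sum>s'\<in>UNIV. cost_excess A \<alpha> u s0 s' * \<zeta> s a s' \<omega>) - Z s a"
      using sum_\<zeta>[OF a \<omega>] by (simp add: sum.distrib sum_subtractf Z_def flip: sum_distrib_left)
    \<comment> \<open>The term of \<open>s0\<close> drops out, because the excess vanishes there.\<close>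
    also have "(\<Sum>s'\<in>UNIV. cost_excess A \<alpha> u s0 s' * \<zeta> s a s' \<omega>) = Y (s, a)"
      unfolding Y_def perturbation_def by (subst sum.remove[of UNIV s0]) (auto simp: cost_excess_def)
    finally show ?thesis .
  qed
  have "discounted_cost A \<alpha> \<gamma> p c f \<omega> = (\<Sum>(s, a)\<in>state_actions A.
      \<rho> $ (s, a) * (c s a \<omega> + \<alpha> * (\<Sum>s'\<in>UNIV. \<zeta> s a s' \<omega> * v $ s')))"
    unfolding v_def by (rule discounted_cost_occupation[OF f \<omega> \<rho> \<rho>f])
  also have "\<dots> \<le> (\<Sum>(s, a)\<in>state_actions A. \<rho> $ (s, a) * (u s a + \<alpha> * (Y (s, a) - Z s a)))"
  proof (rule sum_mono, clarify)
    fix s a assume x: "(s, a) \<in> state_actions A"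
    then have a: "a \<in> A s" by (simp add: state_actions_def)
    have "0 \<le> \<rho> $ (s, a)" using \<rho> x by (auto simp: occupation_measures_def)
    then show "\<rho> $ (s, a) * (c s a \<omega> + \<alpha> * (\<Sum>s'\<in>UNIV. \<zeta> s a s' \<omega> * v $ s'))
        \<le> \<rho> $ (s, a) * (u s a + \<alpha> * (Y (s, a) - Z s a))"
      using c[OF a] noise[OF a] discount by (intro mult_left_mono add_mono) auto
  qed
  also have "\<dots> = (\<Sum>(s, a)\<in>state_actions A. \<rho> $ (s, a) * u s a)
      + \<alpha> * (\<Sum>x\<in>state_actions A. \<rho> $ x * Y x) - \<alpha> * (\<Sum>(s, a)\<in>state_actions A. \<rho> $ (s, a) * Z s a)"
    by (simp add: case_prod_unfold distrib_left right_diff_distrib sum.distrib sum_subtractf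
        sum_distrib_left mult.left_commute)
  also have "\<alpha> * (\<Sum>x\<in>state_actions A. \<rho> $ x * Y x) \<le> \<alpha> * residual A \<alpha> u l \<zeta>l t \<rho>"
    using X discount unfolding Y_def by (intro mult_left_mono) auto
  also have "\<alpha> * residual A \<alpha> u l \<zeta>l t \<rho> = t - (\<Sum>(s, a)\<in>state_actions A. \<rho> $ (s, a) * u s a)
      + \<alpha> * (\<Sum>(s, a)\<in>state_actions A. \<rho> $ (s, a) * Z s a)"
    using discount by (simp add: residual_def Z_def sum_distrib_left mult.assoc)
  finally show ?thesis by simp
qed

lemma \<zeta>_integrable_centred:
  assumes a: "a \<in> A s"
  shows "integrable M (\<zeta> s a s')" "expectation (\<zeta> s a s') = 0"
proof -
  have \<zeta>: "\<zeta> s a s' \<omega> = p s a s' \<omega> - \<mu> s a s'" if "\<omega> \<in> space M" for \<omega>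
    using p_decomp[OF a that] by simp
  have "p s a s' \<omega> \<le> 1" if "\<omega> \<in> space M" for \<omega>
    using member_le_sum[of s' UNIV "\<lambda>s'. p s a s' \<omega>"] p_distr[OF a that] by simp
  then have "integrable M (p s a s')"
    using p_meas[OF a] p_distr(1)[OF a]
    by (intro integrable_const_bound[where B=1] AE_I2) auto
  then show "integrable M (\<zeta> s a s')" "expectation (\<zeta> s a s') = 0"
    using \<zeta> \<mu>_mean[OF a, of s']
    by (simp_all add: prob_space cong: Bochner_Integration.integrable_cong Bochner_Integration.integral_cong)
qed

text \<open>\<open>chernoff_chord_bound\<close> with the ranges of the perturbations as given by \<open>\<zeta>l\<close> and \<open>\<zeta>u\<close>. As \<open>W \<ge> 0\<close>, the
lower and upper noise bounds give the lower and upper end of each range, and the weight of the chord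
is \<open>mixing_coeff\<close>.\<close>

lemma perturbation_tail:
  assumes W: "\<And>s'. 0 \<le> W s'" and h: "0 < h"
  shows "prob {\<omega> \<in> space M. r \<le> (\<Sum>x\<in>state_actions A. \<rho> $ x * perturbation W s0 x \<omega>)}
    \<le> exp (log_mgf_bound A W s0 \<zeta>l \<zeta>u h \<rho> - h * r)"
proof -
  let ?L = "\<lambda>x. \<Sum>s'\<in>UNIV - {s0}. W s' * \<zeta>l (fst x) (snd x) s'"
  let ?U = "\<lambda>x. \<Sum>s'\<in>UNIV - {s0}. W s' * \<zeta>u (fst x) (snd x) s'"
  have "indep_vars (\<lambda>_. borel) (\<lambda>x \<omega>. \<Sum>s'\<in>UNIV - {s0}.
      W s' * ((\<lambda>(s, a) \<omega>. \<chi> s'. \<zeta> s a s' \<omega>) x \<omega> :: real ^ 's) $ s') (state_actions A)"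
    by (rule indep_vars_compose2[OF \<zeta>_indep]) (intro borel_measurable_continuous_onI continuous_intros)
  then have indep: "indep_vars (\<lambda>_. borel) (perturbation W s0) (state_actions A)"
    by (simp add: perturbation_def[abs_def] case_prod_unfold)
  have bounds: "?L x \<le> perturbation W s0 x \<omega> \<and> perturbation W s0 x \<omega> \<le> ?U x"
    if "x \<in> state_actions A" "\<omega> \<in> space M" for x \<omega>
    using that \<zeta>_bounds W
    by (auto simp: perturbation_def state_actions_def intro!: sum_mono mult_left_mono)
  have mean: "expectation (perturbation W s0 x) = 0" if "x \<in> state_actions A" for x
    using that \<zeta>_integrable_centred by (auto simp: perturbation_def[abs_def] state_actions_def)
  have coeff: "mixing_coeff W s0 \<zeta>l \<zeta>u s a = - ?L (s, a) / (?U (s, a) - ?L (s, a))" for s a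
    by (simp add: mixing_coeff_def right_diff_distrib sum_subtractf)
  have "prob {\<omega> \<in> space M. r \<le> (\<Sum>x\<in>state_actions A. \<rho> $ x * perturbation W s0 x \<omega>)} \<le> exp (- h * r) *
    (\<Prod>x\<in>state_actions A. (- ?L x / (?U x - ?L x)) * exp (h * \<rho> $ x * ?U x) +
             (1 - - ?L x / (?U x - ?L x)) * exp (h * \<rho> $ x * ?L x))"
    by (rule chernoff_chord_bound[OF finite_state_actions indep bounds mean h])
  also have "\<dots> = exp (- h * r) * exp (log_mgf_bound A W s0 \<zeta>l \<zeta>u h \<rho>)"
    by (subst exp_log_mgf_bound[OF W \<zeta>_signs]) (simp_all add: case_prod_unfold coeff)
  finally show ?thesis by (simp flip: exp_add)
qed

text \<open>The estimate for a single cost. It bounds the probability of violation instead of its complement,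
which is the form that the union bound needs.\<close>

lemma cost_exceedance:
  assumes f: "f \<in> stationary_policies A"
    and \<rho>: "\<rho> \<in> occupation_measures A \<alpha> \<mu> \<gamma>"
    and \<rho>f: "\<And>s a. a \<in> A s \<Longrightarrow> \<rho> $ (s, a) = (\<Sum>b\<in>A s. \<rho> $ (s, b)) * f s a"
    and c: "\<And>s a \<omega>. a \<in> A s \<Longrightarrow> \<omega> \<in> space M \<Longrightarrow> l s a \<le> c s a \<omega> \<and> c s a \<omega> \<le> u s a"
    and s0: "\<And>s'. cost_max A \<alpha> u s0 \<le> cost_max A \<alpha> u s'"
    and h: "0 < h" and \<epsilon>: "0 < \<epsilon>"
    and bound: "log_mgf_bound A (cost_excess A \<alpha> u s0) s0 \<zeta>l \<zeta>u h \<rho> \<le> ln \<epsilon> + h * residual A \<alpha> u l \<zeta>l t \<rho>"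
  shows "prob {\<omega> \<in> space M. t < discounted_cost A \<alpha> \<gamma> p c f \<omega>} \<le> \<epsilon>"
proof -
  let ?W = "cost_excess A \<alpha> u s0" and ?r = "residual A \<alpha> u l \<zeta>l t \<rho>"
  let ?X = "\<lambda>\<omega>. \<Sum>x\<in>state_actions A. \<rho> $ x * perturbation ?W s0 x \<omega>"
  have "perturbation ?W s0 x \<in> borel_measurable M" if "x \<in> state_actions A" for x
    using that \<zeta>_integrable_centred(1) by (auto simp: perturbation_def[abs_def] state_actions_def)
  then have X: "?X \<in> borel_measurable M" by simp
  have "{\<omega> \<in> space M. t < discounted_cost A \<alpha> \<gamma> p c f \<omega>} \<subseteq> {\<omega> \<in> space M. ?r \<le> ?X \<omega>}"
  proof clarsimp
    fix \<omega> assume \<omega>: "\<omega> \<in> space M" and "t < discounted_cost A \<alpha> \<gamma> p c f \<omega>"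
    then have "\<not> ?X \<omega> \<le> ?r"
      using discounted_cost_le[where \<rho>=\<rho> and c=c and l=l and u=u and t=t and ?s0.0=s0, OF f \<omega> \<rho> \<rho>f c[OF _ \<omega>]] by linarith
    then show "?r \<le> ?X \<omega>" by simp
  qed
  then have "prob {\<omega> \<in> space M. t < discounted_cost A \<alpha> \<gamma> p c f \<omega>} \<le> prob {\<omega> \<in> space M. ?r \<le> ?X \<omega>}"
    using X by (intro finite_measure_mono) auto
  also have "\<dots> \<le> exp (log_mgf_bound A ?W s0 \<zeta>l \<zeta>u h \<rho> - h * ?r)"
    using s0 by (intro perturbation_tail h) (simp add: cost_excess_def)
  also have "\<dots> \<le> exp (ln \<epsilon>)" using bound by simp
  finally show ?thesis using \<epsilon> by simp
qed

end

section \<open>Comparison of the optimal values\<close>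

theorem theorem9:
  fixes M :: "'w measure"
    and A :: "'s::finite \<Rightarrow> 'a::finite set"
    and \<alpha> p0 p1 h0 :: real
    and \<gamma> :: "real ^ 's"
    and K :: nat
    and \<xi> h :: "nat \<Rightarrow> real"
    and c :: "'s \<Rightarrow> 'a \<Rightarrow> 'w \<Rightarrow> real"
    and d :: "nat \<Rightarrow> 's \<Rightarrow> 'a \<Rightarrow> 'w \<Rightarrow> real"
    and p \<zeta> :: "'s \<Rightarrow> 'a \<Rightarrow> 's \<Rightarrow> 'w \<Rightarrow> real"
    and \<mu> \<zeta>l \<zeta>u :: "'s \<Rightarrow> 'a \<Rightarrow> 's \<Rightarrow> real"
    and cl cu :: "'s \<Rightarrow> 'a \<Rightarrow> real"
    and dl du :: "nat \<Rightarrow> 's \<Rightarrow> 'a \<Rightarrow> real"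
    and sc :: 's and sd :: "nat \<Rightarrow> 's"
  assumes prob: "prob_space M"
    and actions: "\<And>s. A s \<noteq> {}"
    and discount: "0 < \<alpha>" "\<alpha> < 1"
    and initial: "\<And>s. 0 \<le> \<gamma> $ s" "(\<Sum>s\<in>UNIV. \<gamma> $ s) = 1"
    and levels: "0 < p0" "p0 < 1" "0 < p1" "p1 < 1"
    and c_meas: "\<And>s a. a \<in> A s \<Longrightarrow> c s a \<in> borel_measurable M"
    and d_meas: "\<And>k s a. k \<in> {1..K} \<Longrightarrow> a \<in> A s \<Longrightarrow> d k s a \<in> borel_measurable M"
    and p_meas: "\<And>s a s'. a \<in> A s \<Longrightarrow> p s a s' \<in> borel_measurable M"
    and p_distr: "\<And>s a s' \<omega>. a \<in> A s \<Longrightarrow> \<omega> \<in> space M \<Longrightarrow> 0 \<le> p s a s' \<omega>"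
                 "\<And>s a \<omega>. a \<in> A s \<Longrightarrow> \<omega> \<in> space M \<Longrightarrow> (\<Sum>s'\<in>UNIV. p s a s' \<omega>) = 1"
    and \<mu>_mean: "\<And>s a s'. a \<in> A s \<Longrightarrow> \<mu> s a s' = prob_space.expectation M (p s a s')"
    and \<mu>_distr: "\<And>s a s'. a \<in> A s \<Longrightarrow> 0 \<le> \<mu> s a s'"
                 "\<And>s a. a \<in> A s \<Longrightarrow> (\<Sum>s'\<in>UNIV. \<mu> s a s') = 1"
    and p_decomp: "\<And>s a s' \<omega>. a \<in> A s \<Longrightarrow> \<omega> \<in> space M \<Longrightarrow> p s a s' \<omega> = \<mu> s a s' + \<zeta> s a s' \<omega>"
    and c_bounds: "\<And>s a \<omega>. a \<in> A s \<Longrightarrow> \<omega> \<in> space M \<Longrightarrow> cl s a \<le> c s a \<omega> \<and> c s a \<omega> \<le> cu s a"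
    and d_bounds: "\<And>k s a \<omega>. k \<in> {1..K} \<Longrightarrow> a \<in> A s \<Longrightarrow> \<omega> \<in> space M \<Longrightarrow>
                     dl k s a \<le> d k s a \<omega> \<and> d k s a \<omega> \<le> du k s a"
    and \<zeta>_bounds: "\<And>s a s' \<omega>. a \<in> A s \<Longrightarrow> \<omega> \<in> space M \<Longrightarrow>
                     \<zeta>l s a s' \<le> \<zeta> s a s' \<omega> \<and> \<zeta> s a s' \<omega> \<le> \<zeta>u s a s'"
    and \<zeta>_signs: "\<And>s a s'. a \<in> A s \<Longrightarrow> 0 \<le> \<zeta>u s a s' \<and> \<zeta>l s a s' \<le> 0"
    and \<zeta>_indep: "prob_space.indep_vars M (\<lambda>_. borel :: (real ^ 's) measure)
                     (\<lambda>(s, a) \<omega>. \<chi> s'. \<zeta> s a s' \<omega>) (state_actions A)"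
    and sc_argmin: "\<And>s'. cost_max A \<alpha> cu sc \<le> cost_max A \<alpha> cu s'"
    and sd_argmin: "\<And>k s'. k \<in> {1..K} \<Longrightarrow> cost_max A \<alpha> (du k) (sd k) \<le> cost_max A \<alpha> (du k) s'"
    and h_pos: "0 < h0" "\<And>k. k \<in> {1..K} \<Longrightarrow> 0 < h k"
  shows "let P = surrogate_program A \<alpha> \<gamma> \<mu> \<zeta>l \<zeta>u cl cu dl du K \<xi> p0 p1 sc sd h0 h in
           convex_program P \<and>
           optimal_value fst (jccmdp_feasible M A \<alpha> \<gamma> p c d K \<xi> p0 p1)
             \<le> optimal_value (objective P) (program_feasible P)"
proof -
  let ?P = "surrogate_program A \<alpha> \<gamma> \<mu> \<zeta>l \<zeta>u cl cu dl du K \<xi> p0 p1 sc sd h0 h"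
  interpret uncertain_mdp M A \<alpha> p \<zeta> \<mu> \<zeta>l \<zeta>u
    using prob actions discount p_meas p_distr \<mu>_mean \<mu>_distr(2) p_decomp \<zeta>_bounds \<zeta>_signs \<zeta>_indep
    by (simp add: uncertain_mdp_def uncertain_mdp_axioms_def)
  have attained: "z \<in> fst ` jccmdp_feasible M A \<alpha> \<gamma> p c d K \<xi> p0 p1"
    if feasible: "(z, \<rho>) \<in> program_feasible ?P" for z \<rho>
  proof -
    have \<rho>: "\<rho> \<in> occupation_measures A \<alpha> \<mu> \<gamma>"
      and c_bound: "log_mgf_bound A (cost_excess A \<alpha> cu sc) sc \<zeta>l \<zeta>u h0 \<rho>
          \<le> ln (1 - p0) + h0 * residual A \<alpha> cu cl \<zeta>l z \<rho>"
      and d_bound: "\<And>k. k \<in> {1..K} \<Longrightarrow> log_mgf_bound A (cost_excess A \<alpha> (du k) (sd k)) (sd k) \<zeta>l \<zeta>u (h k) \<rho>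
          \<le> ln ((1 - p1) / real K) + h k * residual A \<alpha> (du k) (dl k) \<zeta>l (\<xi> k) \<rho>"
      using feasible unfolding surrogate_program_feasible by auto
    obtain f where f: "f \<in> stationary_policies A"
      and \<rho>f: "\<And>s a. a \<in> A s \<Longrightarrow> \<rho> $ (s, a) = (\<Sum>b\<in>A s. \<rho> $ (s, b)) * f s a"
      using occupation_measure_factorizes[OF \<rho> actions] by blast
    let ?C = "discounted_cost A \<alpha> \<gamma> p c f" and ?D = "\<lambda>k. discounted_cost A \<alpha> \<gamma> p (d k) f"
    have D: "?D k \<in> borel_measurable M" if "k \<in> {1..K}" for k
      using f d_meas that by (auto intro!: borel_measurable_discounted_cost)
    have C: "?C \<in> borel_measurable M"
      using f c_meas by (auto intro!: borel_measurable_discounted_cost)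
    have "prob {\<omega> \<in> space M. z < ?C \<omega>} \<le> 1 - p0"
      using levels h_pos(1)
      by (intro cost_exceedance[OF f \<rho> \<rho>f c_bounds sc_argmin _ _ c_bound]) auto
    moreover have "prob {\<omega> \<in> space M. z < ?C \<omega>} = 1 - prob {\<omega> \<in> space M. ?C \<omega> \<le> z}"
      using C by (subst prob_neg[symmetric]) (auto simp: not_le)
    ultimately have p0: "p0 \<le> prob {\<omega> \<in> space M. ?C \<omega> \<le> z}" by simp
    \<comment> \<open>The joint constraint distributes the risk \<open>1 - p1\<close> equally among the \<open>K\<close> costs.\<close>
    have "prob {\<omega> \<in> space M. \<not> (\<forall>k\<in>{1..K}. ?D k \<omega> \<le> \<xi> k)}
        = prob (\<Union>k\<in>{1..K}. {\<omega> \<in> space M. \<xi> k < ?D k \<omega>})"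
      by (intro arg_cong[where f=prob]) (auto simp: not_le)
    also have "\<dots> \<le> (\<Sum>k\<in>{1..K}. prob {\<omega> \<in> space M. \<xi> k < ?D k \<omega>})"
      using D by (intro finite_measure_subadditive_finite) auto
    also have "\<dots> \<le> (\<Sum>k\<in>{1..K}. (1 - p1) / real K)"
    proof (rule sum_mono)
      fix k assume k: "k \<in> {1..K}"
      then show "prob {\<omega> \<in> space M. \<xi> k < ?D k \<omega>} \<le> (1 - p1) / real K"
        using levels h_pos(2)[OF k]
        by (intro cost_exceedance[OF f \<rho> \<rho>f d_bounds[OF k] sd_argmin[OF k] _ _ d_bound[OF k]]) auto
    qed
    \<comment> \<open>An inequality only, since the sum is empty for \<open>K = 0\<close>.\<close>
    also have "\<dots> \<le> 1 - p1" using levels by simp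
    finally have "prob {\<omega> \<in> space M. \<not> (\<forall>k\<in>{1..K}. ?D k \<omega> \<le> \<xi> k)} \<le> 1 - p1" .
    moreover have "{\<omega> \<in> space M. \<forall>k\<in>{1..K}. ?D k \<omega> \<le> \<xi> k} \<in> events"
      using D by (intro sets.sets_Collect_finite_All) auto
    ultimately have p1: "p1 \<le> prob {\<omega> \<in> space M. \<forall>k\<in>{1..K}. ?D k \<omega> \<le> \<xi> k}"
      using prob_neg[of "\<lambda>\<omega>. \<forall>k\<in>{1..K}. ?D k \<omega> \<le> \<xi> k"] by linarith
    have "(z, f) \<in> jccmdp_feasible M A \<alpha> \<gamma> p c d K \<xi> p0 p1"
      unfolding jccmdp_feasible_def using f p0 p1 by simp
    then show ?thesis by force
  qed
  have "optimal_value fst (jccmdp_feasible M A \<alpha> \<gamma> p c d K \<xi> p0 p1)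
      \<le> optimal_value (objective ?P) (program_feasible ?P)"
    unfolding optimal_value_def
  proof (rule INF_greatest)
    fix x assume x: "x \<in> program_feasible ?P"
    have "objective ?P x = fst x" by (simp add: surrogate_program_def case_prod_unfold)
    moreover have "fst x \<in> fst ` jccmdp_feasible M A \<alpha> \<gamma> p c d K \<xi> p0 p1"
      using attained[of "fst x" "snd x"] x by simp
    ultimately show "(INF y\<in>jccmdp_feasible M A \<alpha> \<gamma> p c d K \<xi> p0 p1. ereal (fst y)) \<le> ereal (objective ?P x)"
      by (auto intro: INF_lower2)
  qed
  moreover have "convex_program ?P"
    using \<zeta>_signs sc_argmin sd_argmin by (intro convex_program_surrogate) auto
  ultimately show ?thesis
    unfolding Let_def by blast
qed

end
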